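(* Let $B,\lambda>0$, $q\in\mathbb N$, $\alpha\in(0,1]$ with $\beta=q+\alpha\ge1/2$, $T\ge2$, and let $\mathcal F$ be the set of functions $f:[0,1]\to\mathbb R$ that are $q$ times differentiable with $\|f^{(k)}\|_\infty\le B$ for $k=0,\ldots,q$ and $|f^{(q)}(x)-f^{(q)}(y)|\le\lambda|x-y|^\alpha$ for all $x,y$. Let $(x_t)$ be any sequence in $[0,1]$ and $(y_t)$ any real sequence with $\max_{1\le t\le T}|y_t|\le B$. Then the Nested Chaining Algorithm for Hölder functions (described in the context), tuned with $\gamma=BT^{-\beta/(2\beta+1)}$, $\delta_x=2(q!\gamma/(2\lambda))^{1/\beta}$, $\delta_y=\gamma/e$, and $M=\lceil\log_2(\gamma T/B)\rceil$, satisfies, for a constant $c>0$ depending only on $q$ and $\lambda$, $$\sum_{t=1}^T(y_t-\hat y_t)^2-\inf_{f\in\mathcal F}\sum_{t=1}^T(y_t-f(x_t))^2\le c\max\{B^{2-1/\beta},B^2\}\,T^{\frac1{2\beta+1}}(\log T)^{3/2}.$$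
   Context: Online protocol: at round $t$, $x_t$ is revealed, the forecaster predicts $\hat y_t$, then $y_t$ is revealed. Assume $1/\delta_x$ and $2B/\delta_y$ are integers. $[x]_c=\min\{c,\max\{-c,x\}\}$. Discretization: $I_a=[(a-1)\delta_x,a\delta_x)$, $a=1,\ldots,1/\delta_x$ (last closed at $1$), centers $x_a$; for $m\ge1$, $I_a$ is split into $4^m$ consecutive subintervals $I_a^{(m,n)}$ of length $\delta_x/4^m$, centers $x_a^{(m,n)}$; $n_{m-1}$ is the index with $I_a^{(m,n)}\subset I_a^{(m-1,n_{m-1})}$. $\mathcal Y^{(m)}=\{-B+j\delta_y/2^m:j=0,\ldots,2^{m+1}B/\delta_y\}$. $\mathcal P_a^{(0)}$: functions $x\mapsto[\sum_{i=0}^q\frac{a_i}{i!}(x-x_a)^i]_B$ with $a_i\in\mathcal Y^{(0)}$; $\mathcal P_a^{(m,n)}$: functions $x\mapsto[\sum_{i=0}^q\frac{a_i}{i!}(x-x_a^{(m,n)})^i]_B$ with $a_i\in\mathcal Y^{(m)}$; $\mathcal Q_a^{(m,n)}=\{[P-P']_{3\gamma/2^m}:P\in\mathcal P_a^{(m,n)},P'\in\mathcal P_a^{(m-1,n_{m-1})}\}$ (with $\mathcal P_a^{(0)}$ replacing $\mathcal P_a^{(m-1,n_{m-1})}$ when $m=1$), enumerated as $Q^{(m,n)}_{a,1},Q^{(m,n)}_{a,2},\ldots$. Adaptive Multi-variable Exponentiated Gradient (AMEG) on a product of simplices $\prod_k\Delta_{N_k}$ with gradient bounds $G^{(k)}$: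 start uniform; at each of its rounds it outputs weights, receives a differentiable jointly convex loss $\ell_t$, sets $\eta^{(k)}_{t+1}=\frac1{G^{(k)}}\sqrt{\log N_k/(1+\#\{s\le t:\text{the }k\text{-th partial gradient of }\ell_s\text{ is not identically }0\})}$ and $\hat u^{(k)}_{t+1,i}\propto\exp(-\eta^{(k)}_{t+1}\sum_{s\le t}\partial_{u^{(k)}_i}\ell_s(\hat{\boldsymbol u}_s))$. Algorithm: for each $a$, an independent instance fed only rounds with $x_t\in I_a$. For each $P^{(0)}_{a,j}\in\mathcal P_a^{(0)}$ (enumerated by $j$), run AMEG instance $\mathcal B_{a,j}$ with blocks $\boldsymbol u^{(m,n)}\in\Delta_{|\mathcal Q_a^{(m,n)}|}$, $1\le m\le M$, $1\le n\le4^m$, gradient bounds $30B\gamma/2^m$, and losses $\ell_t(\boldsymbol u)=\big(y_t-P^{(0)}_{a,j}(x_t)-\sum_{m,n}\sum_ku^{(m,n)}_kQ^{(m,n)}_{a,k}(x_t)\mathbb 1\{x_t\in I_a^{(m,n)}\}\big)^2$; with its current weights define $\hat f_{t,a,j}(x)=P^{(0)}_{a,j}(x)+\sum_{m,n,k}\hat u^{(m,n)}_{t,a,j,k}Q^{(m,n)}_{a,k}(x)\mathbb 1\{x\in I_a^{(m,n)}\}$. Aggregate: $\hat f_{t,a}=\sum_j\hat w_{t,a,j}\hat f_{t,a,j}$ with $\hat w_{t,a,j}\propto\exp(-\eta\sum_{s<t,x_s\in I_a}(y_s-\hat f_{s,a,j}(x_s))^2)$, $\eta=1/(50B^2)$.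 Predict $\hat y_t=\sum_a\hat f_{t,a}(x_t)\mathbb 1\{x_t\in I_a\}$.
   Formalization: Since the tuned δ_y = γ/e generally makes 2B/δ_y = 2eT^{β/(2β+1)} a non-integer, contrary to the standing assumption, the algorithm is run with ⌈1/δ_x⌉ cells and ⌈2B/δ_y⌉ grid steps, i.e. with δ_x and δ_y rounded down so that 1/δ_x and 2B/δ_y are integers. *)

theory Defs
  imports Complex_Main
begin

definition clip :: "real \<Rightarrow> real \<Rightarrow> real" where
  "clip c v = min c (max (-c) v)"

definition in_cell :: "nat \<Rightarrow> nat \<Rightarrow> real \<Rightarrow> bool" where
  "in_cell Nx a x \<longleftrightarrow> real (a - 1) / real Nx \<le> x \<and> (x < real a / real Nx \<or> (a = Nx \<and> x = 1))"

definition cell_center :: "nat \<Rightarrow> nat \<Rightarrow> real" where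
  "cell_center Nx a = (real a - 1/2) / real Nx"

definition sub_lo :: "nat \<Rightarrow> nat \<Rightarrow> nat \<Rightarrow> nat \<Rightarrow> real" where
  "sub_lo Nx a m n = real (a - 1) / real Nx + real (n - 1) / (real Nx * 4 ^ m)"

definition in_sub :: "nat \<Rightarrow> nat \<Rightarrow> nat \<Rightarrow> nat \<Rightarrow> real \<Rightarrow> bool" where
  "in_sub Nx a m n x \<longleftrightarrow> sub_lo Nx a m n \<le> x \<and>
     (x < sub_lo Nx a m n + 1 / (real Nx * 4 ^ m) \<or> (a = Nx \<and> n = 4 ^ m \<and> x = 1))"

definition sub_center :: "nat \<Rightarrow> nat \<Rightarrow> nat \<Rightarrow> nat \<Rightarrow> real" where
  "sub_center Nx a m n = sub_lo Nx a m n + 1 / (2 * real Nx * 4 ^ m)"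

definition parent :: "nat \<Rightarrow> nat" where
  "parent n = (n - 1) div 4 + 1"

definition grid :: "real \<Rightarrow> nat \<Rightarrow> nat \<Rightarrow> real set" where
  "grid B Ny m = {- B + real j * (2 * B / real Ny) / 2 ^ m | j. j \<le> 2 ^ m * Ny}"

definition taylor_poly :: "real \<Rightarrow> nat \<Rightarrow> real \<Rightarrow> (nat \<Rightarrow> real) \<Rightarrow> real \<Rightarrow> real" where
  "taylor_poly B q c cs = (\<lambda>z. clip B (\<Sum>i\<le>q. cs i / fact i * (z - c) ^ i))"

definition poly_class :: "real \<Rightarrow> nat \<Rightarrow> nat \<Rightarrow> nat \<Rightarrow> real \<Rightarrow> (real \<Rightarrow> real) set" where
  "poly_class B q Ny m c = {taylor_poly B q c cs | cs. \<forall>i\<le>q. cs i \<in> grid B Ny m}"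

definition P0 :: "real \<Rightarrow> nat \<Rightarrow> nat \<Rightarrow> nat \<Rightarrow> nat \<Rightarrow> (real \<Rightarrow> real) set" where
  "P0 B q Nx Ny a = poly_class B q Ny 0 (cell_center Nx a)"

definition Pmn :: "real \<Rightarrow> nat \<Rightarrow> nat \<Rightarrow> nat \<Rightarrow> nat \<Rightarrow> nat \<Rightarrow> nat \<Rightarrow> (real \<Rightarrow> real) set" where
  "Pmn B q Nx Ny a m n = poly_class B q Ny m (sub_center Nx a m n)"

definition Qset :: "real \<Rightarrow> nat \<Rightarrow> real \<Rightarrow> nat \<Rightarrow> nat \<Rightarrow> nat \<Rightarrow> nat \<Rightarrow> nat \<Rightarrow> (real \<Rightarrow> real) set" where
  "Qset B q gam Nx Ny a m n =
     {(\<lambda>z. clip (3 * gam / 2 ^ m) (P z - P' z)) | P P'.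
        P \<in> Pmn B q Nx Ny a m n \<and>
        P' \<in> (if m = 1 then P0 B q Nx Ny a else Pmn B q Nx Ny a (m - 1) (parent n))}"

definition blocks :: "nat \<Rightarrow> (nat \<times> nat) set" where
  "blocks M = {(m, n). 1 \<le> m \<and> m \<le> M \<and> 1 \<le> n \<and> n \<le> 4 ^ m}"

type_synonym weights = "nat \<times> nat \<Rightarrow> (real \<Rightarrow> real) \<Rightarrow> real"

definition expert_fun :: "real \<Rightarrow> nat \<Rightarrow> real \<Rightarrow> nat \<Rightarrow> nat \<Rightarrow> nat \<Rightarrow> nat \<Rightarrow> (real \<Rightarrow> real)
    \<Rightarrow> weights \<Rightarrow> real \<Rightarrow> real" where
  "expert_fun B q gam Nx Ny M a P u = (\<lambda>z. P z +
     (\<Sum>(m, n)\<in>blocks M. \<Sum>Q\<in>Qset B q gam Nx Ny a m n.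
        u (m, n) Q * Q z * (if in_sub Nx a m n z then 1 else 0)))"

definition in_simplices :: "real \<Rightarrow> nat \<Rightarrow> real \<Rightarrow> nat \<Rightarrow> nat \<Rightarrow> nat \<Rightarrow> nat \<Rightarrow> weights \<Rightarrow> bool" where
  "in_simplices B q gam Nx Ny M a u \<longleftrightarrow>
     (\<forall>(m, n)\<in>blocks M. (\<forall>Q\<in>Qset B q gam Nx Ny a m n. 0 \<le> u (m, n) Q) \<and>
        (\<Sum>Q\<in>Qset B q gam Nx Ny a m n. u (m, n) Q) = 1)"

text \<open>Partial derivative of the square loss l_t(u) = (y_t - P(x_t) - sum u Q(x_t) 1{x_t in I^(m,n)})^2
  with respect to the coordinate u^(m,n)_Q.\<close>
definition loss_grad :: "real \<Rightarrow> nat \<Rightarrow> real \<Rightarrow> nat \<Rightarrow> nat \<Rightarrow> nat \<Rightarrow> nat \<Rightarrow> (real \<Rightarrow> real)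
    \<Rightarrow> weights \<Rightarrow> real \<Rightarrow> real \<Rightarrow> nat \<Rightarrow> nat \<Rightarrow> (real \<Rightarrow> real) \<Rightarrow> real" where
  "loss_grad B q gam Nx Ny M a P u xt yt m n Q =
     - 2 * (yt - expert_fun B q gam Nx Ny M a P u xt) * Q xt * (if in_sub Nx a m n xt then 1 else 0)"

definition grad_active :: "real \<Rightarrow> nat \<Rightarrow> real \<Rightarrow> nat \<Rightarrow> nat \<Rightarrow> nat \<Rightarrow> nat \<Rightarrow> (real \<Rightarrow> real)
    \<Rightarrow> real \<Rightarrow> real \<Rightarrow> nat \<Rightarrow> nat \<Rightarrow> bool" where
  "grad_active B q gam Nx Ny M a P xt yt m n \<longleftrightarrow>
     (\<exists>u. in_simplices B q gam Nx Ny M a u \<and>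
        (\<exists>Q\<in>Qset B q gam Nx Ny a m n. loss_grad B q gam Nx Ny M a P u xt yt m n Q \<noteq> 0))"

text \<open>AMEG weights from cumulative gradients G and counts C of active rounds
  (gradient bound G^(m,n) = 30 B gam / 2^m).\<close>
definition ameg_weights :: "real \<Rightarrow> nat \<Rightarrow> real \<Rightarrow> nat \<Rightarrow> nat \<Rightarrow> nat
    \<Rightarrow> (nat \<times> nat \<Rightarrow> (real \<Rightarrow> real) \<Rightarrow> real) \<Rightarrow> (nat \<times> nat \<Rightarrow> nat) \<Rightarrow> weights" where
  "ameg_weights B q gam Nx Ny a G C = (\<lambda>(m, n) Q.
     let eta = (1 / (30 * B * gam / 2 ^ m)) *
               sqrt (ln (real (card (Qset B q gam Nx Ny a m n))) / (1 + real (C (m, n))))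
     in exp (- eta * G (m, n) Q) / (\<Sum>Q'\<in>Qset B q gam Nx Ny a m n. exp (- eta * G (m, n) Q')))"

type_synonym nca_st =
  "(nat \<Rightarrow> (real \<Rightarrow> real) \<Rightarrow> nat \<times> nat \<Rightarrow> (real \<Rightarrow> real) \<Rightarrow> real) \<times>
   (nat \<Rightarrow> (real \<Rightarrow> real) \<Rightarrow> nat \<times> nat \<Rightarrow> nat) \<times>
   (nat \<Rightarrow> (real \<Rightarrow> real) \<Rightarrow> real)"

text \<open>State after rounds 1..t: for each cell a and base polynomial P (the instance B_{a,j}):
  cumulative gradients, counts of rounds with non-identically-zero partial gradient,
  and cumulative square loss of f_{s,a,j} (for the exponential-weights aggregation).
  Only rounds with x_s in I_a are fed to the instances of cell a.\<close>
primrec nca_state :: "real \<Rightarrow> nat \<Rightarrow> real \<Rightarrow> nat \<Rightarrow> nat \<Rightarrow> nat \<Rightarrow> (nat \<Rightarrow> real) \<Rightarrow> (nat \<Rightarrow> real)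
    \<Rightarrow> nat \<Rightarrow> nca_st" where
  "nca_state B q gam Nx Ny M xs ys 0 = ((\<lambda>_ _ _ _. 0), (\<lambda>_ _ _. 0), (\<lambda>_ _. 0))"
| "nca_state B q gam Nx Ny M xs ys (Suc t) =
     (case nca_state B q gam Nx Ny M xs ys t of (G, C, L) \<Rightarrow>
       let xt = xs (Suc t); yt = ys (Suc t) in
       ((\<lambda>a P k Q. G a P k Q +
           (if in_cell Nx a xt \<and> k \<in> blocks M
            then loss_grad B q gam Nx Ny M a P (ameg_weights B q gam Nx Ny a (G a P) (C a P))
                   xt yt (fst k) (snd k) Q
            else 0)),
        (\<lambda>a P k. C a P k +
           (if in_cell Nx a xt \<and> k \<in> blocks M \<and>
               grad_active B q gam Nx Ny M a P xt yt (fst k) (snd k) then 1 else 0)),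
        (\<lambda>a P. L a P +
           (if in_cell Nx a xt
            then (yt - expert_fun B q gam Nx Ny M a P
                         (ameg_weights B q gam Nx Ny a (G a P) (C a P)) xt) ^ 2
            else 0))))"

definition nca_predict :: "real \<Rightarrow> nat \<Rightarrow> real \<Rightarrow> nat \<Rightarrow> nat \<Rightarrow> nat \<Rightarrow> (nat \<Rightarrow> real) \<Rightarrow> (nat \<Rightarrow> real)
    \<Rightarrow> nat \<Rightarrow> real" where
  "nca_predict B q gam Nx Ny M xs ys t =
     (case nca_state B q gam Nx Ny M xs ys (t - 1) of (G, C, L) \<Rightarrow>
       (\<Sum>a\<in>{1..Nx}. if in_cell Nx a (xs t) then
          (\<Sum>P\<in>P0 B q Nx Ny a.
             (exp (- (1 / (50 * B ^ 2)) * L a P) /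
              (\<Sum>P'\<in>P0 B q Nx Ny a. exp (- (1 / (50 * B ^ 2)) * L a P'))) *
             expert_fun B q gam Nx Ny M a P (ameg_weights B q gam Nx Ny a (G a P) (C a P)) (xs t))
        else 0))"

text \<open>Tuned algorithm. Since 1/delta_x and 2B/delta_y must be integers, we round them up:
  Nx = ceil(1/delta_x) cells of length 1/Nx, grid step 2B/Ny with Ny = ceil(2B/delta_y).\<close>
definition nca_tuned :: "real \<Rightarrow> nat \<Rightarrow> real \<Rightarrow> real \<Rightarrow> nat \<Rightarrow> (nat \<Rightarrow> real) \<Rightarrow> (nat \<Rightarrow> real) \<Rightarrow> nat \<Rightarrow> real" where
  "nca_tuned B q lam \<alpha> T xs ys t =
     (let \<beta> = real q + \<alpha>;
          gam = B * real T powr (- \<beta> / (2 * \<beta> + 1));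
          dx = 2 * (fact q * gam / (2 * lam)) powr (1 / \<beta>);
          dy = gam / exp 1;
          M = nat \<lceil>log 2 (gam * real T / B)\<rceil>;
          Nx = nat \<lceil>1 / dx\<rceil>;
          Ny = nat \<lceil>2 * B / dy\<rceil>
      in nca_predict B q gam Nx Ny M xs ys t)"

definition holder_class :: "nat \<Rightarrow> real \<Rightarrow> real \<Rightarrow> real \<Rightarrow> (real \<Rightarrow> real) set" where
  "holder_class q B lam \<alpha> = {f. \<exists>D :: nat \<Rightarrow> real \<Rightarrow> real.
     (\<forall>x\<in>{0..1}. D 0 x = f x) \<and>
     (\<forall>k<q. \<forall>x\<in>{0..1}. (D k has_real_derivative D (Suc k) x) (at x within {0..1})) \<and>
     (\<forall>k\<le>q. \<forall>x\<in>{0..1}. \<bar>D k x\<bar> \<le> B) \<and>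
     (\<forall>x\<in>{0..1}. \<forall>y\<in>{0..1}. \<bar>D q x - D q y\<bar> \<le> lam * \<bar>x - y\<bar> powr \<alpha>)}"

end

theory Submission
  imports Defs "HOL-Analysis.Analysis"
begin

text \<open>
  Inside a cell, a Hoelder function is followed through its quantised Taylor polynomials at the scales
  \<open>4 ^ (- m)\<close>; the level-\<open>m\<close> polynomial is within \<open>\<gamma> / 2 ^ m\<close> of the function, so the function is, up to
  \<open>\<gamma> / 2 ^ M \<le> B / T\<close>, a base polynomial plus one element of the difference class of size \<open>3 \<gamma> / 2 ^ m\<close> per
  level. Choosing the base polynomial costs a logarithmic term by exponential concavity of the square
  loss. Choosing the differences costs, by convexity and the adaptive exponentiated gradient bound,
  \<open>B \<gamma> / 2 ^ m\<close> times \<open>sqrt (T' log N)\<close> for a subcell visited \<open>T'\<close> times; Cauchy--Schwarz over the \<open>4 ^ m\<close>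
  subcells of a level cancels the factor \<open>2 ^ m\<close>, and Cauchy--Schwarz over the cells gives a total of
  order \<open>B \<gamma> M sqrt (log N) sqrt (T / \<delta>\<^sub>x)\<close>.
\<close>

section \<open>Exponential weights\<close>

text \<open>The number of visits to a subcell is not known beforehand, so the rate of each block
  must shrink with its own count of active rounds; a potential that is monotone in the rate absorbs
  the change. Base polynomials need another argument: a regret of order \<open>B\<^sup>2\<close>
  times the root of the number of visits would lack the factor \<open>gam\<close>, whereas
  exponential concavity costs only \<open>B\<^sup>2\<close> times a logarithm per cell. Up to
  logarithms, the total is \<open>B * gam * sqrt (Nx * T) + B\<^sup>2 * Nx\<close> with
  \<open>Nx\<close> of order \<open>gam powr (- 1 / \<beta>)\<close>, and the chosen
  \<open>gam\<close> gives both terms the same power \<open>T powr (1 / (2 * \<beta> + 1))\<close>.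
  The factors \<open>M\<close> and \<open>sqrt (ln N)\<close> are of order \<open>ln T\<close> and
  \<open>sqrt (ln T)\<close>, hence the exponent \<open>3/2\<close>. There is always at least one
  cell, however small \<open>1 / dx\<close> is, which is why \<open>B\<^sup>2\<close> stands beside
  \<open>B powr (2 - 1 / \<beta>)\<close>.\<close>

definition gibbs :: "real \<Rightarrow> 'k set \<Rightarrow> ('k \<Rightarrow> real) \<Rightarrow> 'k \<Rightarrow> real" where
  "gibbs \<eta> S G k = exp (- \<eta> * G k) / (\<Sum>j\<in>S. exp (- \<eta> * G j))"

text \<open>The potential of both regret proofs. Averaging over \<open>S\<close> instead of summing
  makes it 0 on the zero vector and monotone in the rate; for \<open>\<eta> > 0\<close> it exceeds
  the minimum of \<open>G\<close> by at most \<open>ln (card S) / \<eta>\<close>.\<close>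

definition softmin :: "real \<Rightarrow> 'k set \<Rightarrow> ('k \<Rightarrow> real) \<Rightarrow> real" where
  "softmin \<eta> S G = - (1 / \<eta>) * ln ((\<Sum>k\<in>S. exp (- \<eta> * G k)) / card S)"

lemma sum_exp_pos:
  assumes "finite S" "S \<noteq> {}"
  shows "0 < (\<Sum>k\<in>S. exp (h k :: real))"
  using assms by (intro sum_pos) auto

lemma gibbs_nonneg: "0 \<le> gibbs \<eta> S G k"
  unfolding gibbs_def by (intro divide_nonneg_nonneg sum_nonneg) auto

lemma sum_gibbs:
  assumes "finite S" "S \<noteq> {}"
  shows "(\<Sum>k\<in>S. gibbs \<eta> S G k) = 1"
  unfolding gibbs_def sum_divide_distrib[symmetric]
  using sum_exp_pos[OF assms, of "\<lambda>k. - \<eta> * G k"] by simp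

lemma abs_average_le:
  fixes w g :: "'k \<Rightarrow> real"
  assumes "\<And>k. k \<in> S \<Longrightarrow> 0 \<le> w k" "(\<Sum>k\<in>S. w k) = 1" "\<And>k. k \<in> S \<Longrightarrow> \<bar>g k\<bar> \<le> b"
  shows "\<bar>\<Sum>k\<in>S. w k * g k\<bar> \<le> b"
proof -
  have "\<bar>\<Sum>k\<in>S. w k * g k\<bar> \<le> (\<Sum>k\<in>S. w k * b)"
    by (rule order_trans[OF sum_abs sum_mono]) (use assms in \<open>auto simp: abs_mult intro!: mult_left_mono\<close>)
  also have "\<dots> = b"
    using assms(2) by (simp add: sum_distrib_right[symmetric])
  finally show ?thesis .
qed

lemma exp_le_quadratic:
  fixes x :: real
  assumes "\<bar>x\<bar> \<le> 1"
  shows "exp x \<le> 1 + x + x\<^sup>2"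
proof (cases "0 \<le> x")
  case True
  then show ?thesis using exp_bound assms by auto
next
  case False
  define y where "y = - x"
  have y: "0 \<le> y" using False by (simp add: y_def)
  have p: "0 \<le> 1 - y + y\<^sup>2"
    using sum_power2_ge_zero[of "y - 1/2" "1/2"] by (simp add: power2_eq_square algebra_simps)
  \<comment> \<open>The product with the quadratic Taylor polynomial of \<open>exp y\<close> is 1
    plus terms with positive coefficients, so \<open>1 - y + y\<^sup>2\<close> dominates
    \<open>exp (- y)\<close>.\<close>
  have "1 + (y\<^sup>2/2 + y^3/2 + y^4/2) = (1 - y + y\<^sup>2) * (1 + y + y\<^sup>2/2)"
    by (simp add: field_simps power2_eq_square power3_eq_cube power4_eq_xxxx)
  also have "\<dots> \<le> (1 - y + y\<^sup>2) * exp y"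
    by (intro mult_left_mono p exp_lower_Taylor_quadratic y)
  finally have "1 \<le> (1 - y + y\<^sup>2) * exp y"
    using y by (smt (verit) divide_nonneg_nonneg zero_le_power)
  then have "exp (- y) \<le> 1 - y + y\<^sup>2"
    by (simp add: exp_minus field_simps)
  then show ?thesis by (simp add: y_def)
qed

text \<open>This is the power mean inequality; it lets the learning rate decrease over time.\<close>
lemma softmin_antimono:
  assumes "0 < \<eta>'" "\<eta>' \<le> \<eta>" "finite S" "S \<noteq> {}"
  shows "softmin \<eta> S G \<le> softmin \<eta>' S G"
proof -
  define p where "p = \<eta> / \<eta>'"
  have p: "p \<ge> 1" using assms by (simp add: p_def)
  define A where "A = (\<Sum>k\<in>S. exp (- \<eta>' * G k)) / card S"
  have N: "real (card S) > 0" using assms by (simp add: card_gt_0_iff)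
  have A: "A > 0" unfolding A_def using N sum_exp_pos[OF assms(3,4)] by simp
  have "(\<Sum>k\<in>S. (1 / card S) *\<^sub>R exp (- \<eta>' * G k)) powr p
        \<le> (\<Sum>k\<in>S. (1 / card S) * exp (- \<eta>' * G k) powr p)"
    using assms N by (intro convex_on_sum[OF _ _ powr_convex[OF p]]) auto
  also have "(\<Sum>k\<in>S. (1 / card S) *\<^sub>R exp (- \<eta>' * G k)) = A"
    by (simp add: A_def sum_divide_distrib)
  also have "(\<Sum>k\<in>S. (1 / card S) * exp (- \<eta>' * G k) powr p) = (\<Sum>k\<in>S. exp (- \<eta> * G k)) / card S"
    using assms by (auto simp: sum_divide_distrib p_def powr_def intro!: sum.cong)
  finally have "ln (A powr p) \<le> ln ((\<Sum>k\<in>S. exp (- \<eta> * G k)) / card S)"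
    using A by (subst ln_le_cancel_iff) (auto intro!: divide_pos_pos N sum_exp_pos assms)
  then have "p * ln A \<le> ln ((\<Sum>k\<in>S. exp (- \<eta> * G k)) / card S)"
    using A by (simp add: ln_powr)
  then have "(1/\<eta>) * (p * ln A) \<le> (1/\<eta>) * ln ((\<Sum>k\<in>S. exp (- \<eta> * G k)) / card S)"
    using assms by (intro mult_left_mono) auto
  moreover have "(1/\<eta>) * (p * ln A) = (1/\<eta>') * ln A"
    using assms by (simp add: p_def)
  ultimately show ?thesis unfolding softmin_def A_def by simp
qed

lemma softmin_le:
  assumes "0 < \<eta>" "finite S" "k \<in> S"
  shows "softmin \<eta> S G \<le> G k + ln (card S) / \<eta>"
proof -
  have N: "real (card S) > 0" using assms by (auto simp: card_gt_0_iff)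
  have "exp (- \<eta> * G k) \<le> (\<Sum>j\<in>S. exp (- \<eta> * G j))"
    using assms by (intro member_le_sum) auto
  then have "ln (exp (- \<eta> * G k) / card S) \<le> ln ((\<Sum>j\<in>S. exp (- \<eta> * G j)) / card S)"
    using N by (subst ln_le_cancel_iff)
      (auto intro!: divide_right_mono divide_pos_pos simp: order_less_le_trans[OF exp_gt_zero])
  then have "- \<eta> * G k - ln (card S) \<le> ln ((\<Sum>j\<in>S. exp (- \<eta> * G j)) / card S)"
    using N by (simp add: ln_div)
  then have "(1/\<eta>) * (- \<eta> * G k - ln (card S)) \<le> (1/\<eta>) * ln ((\<Sum>j\<in>S. exp (- \<eta> * G j)) / card S)"
    using assms by (intro mult_left_mono) auto
  also have "(1/\<eta>) * (- \<eta> * G k - ln (card S)) = - G k - ln (card S) / \<eta>"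
    using assms by (simp add: field_simps)
  finally show ?thesis unfolding softmin_def by simp
qed

text \<open>Hoeffding's lemma with a worse constant: for \<open>\<eta> * b \<ge> 1\<close> the quadratic term alone exceeds
  the range of \<open>g\<close>, otherwise \<open>exp x \<le> 1 + x + x\<^sup>2\<close> applies.\<close>
lemma softmin_step:
  assumes "0 < \<eta>" "finite S" "S \<noteq> {}" "\<And>k. k \<in> S \<Longrightarrow> \<bar>g k\<bar> \<le> b"
  shows "(\<Sum>k\<in>S. gibbs \<eta> S G k * g k)
         \<le> softmin \<eta> S (\<lambda>k. G k + g k) - softmin \<eta> S G + 2 * \<eta> * b\<^sup>2"
proof -
  define w where "w = gibbs \<eta> S G"
  define m where "m = (\<Sum>k\<in>S. w k * g k)"
  define D where "D = (\<Sum>k\<in>S. w k * exp (- \<eta> * g k))"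
  have w0: "0 \<le> w k" for k by (simp add: w_def gibbs_nonneg)
  have w1: "(\<Sum>k\<in>S. w k) = 1" unfolding w_def by (rule sum_gibbs[OF assms(2,3)])
  have N: "real (card S) > 0" using assms by (auto simp: card_gt_0_iff)
  define Z where "Z = (\<Sum>k\<in>S. exp (- \<eta> * G k))"
  have Z: "Z > 0" unfolding Z_def by (rule sum_exp_pos[OF assms(2,3)])
  \<comment> \<open>\<open>D\<close> is the ratio of the new normaliser to the old one, so the
    potential changes by \<open>- (1 / \<eta>) * ln D\<close>.\<close>
  have D_eq: "D = (\<Sum>k\<in>S. exp (- \<eta> * (G k + g k))) / Z"
    by (simp add: D_def w_def gibbs_def Z_def sum_divide_distrib distrib_left exp_add[symmetric])
  have D: "D > 0" unfolding D_eq by (intro divide_pos_pos Z sum_exp_pos assms)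
  have "ln ((\<Sum>k\<in>S. exp (- \<eta> * (G k + g k))) / card S) = ln (D * (Z / card S))"
    using Z by (simp add: D_eq)
  also have "\<dots> = ln D + ln (Z / card S)"
    using D Z N by (intro ln_mult_pos) auto
  finally have diff: "softmin \<eta> S (\<lambda>k. G k + g k) - softmin \<eta> S G = - (1/\<eta>) * ln D"
    unfolding softmin_def Z_def by (simp add: algebra_simps)
  obtain k0 where "k0 \<in> S" using assms by auto
  then have b: "0 \<le> b" using assms(4)[of k0] by linarith
  have m_le: "\<bar>m\<bar> \<le> b" unfolding m_def by (rule abs_average_le) (use w0 w1 assms in auto)
  have "ln D \<le> - \<eta> * m + 2 * (\<eta> * b)\<^sup>2"
  proof (cases "\<eta> * b \<le> 1")
    case True
    have "D \<le> (\<Sum>k\<in>S. w k * (1 - \<eta> * g k + (\<eta> * b)\<^sup>2))"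
      unfolding D_def
    proof (intro sum_mono mult_left_mono w0)
      fix k assume k: "k \<in> S"
      have a: "\<bar>- \<eta> * g k\<bar> \<le> \<eta> * b"
        using assms(1) assms(4)[OF k] by (simp add: abs_mult)
      have "exp (- \<eta> * g k) \<le> 1 + (- \<eta> * g k) + (- \<eta> * g k)\<^sup>2"
        by (rule exp_le_quadratic) (use a True in linarith)
      also have "(- \<eta> * g k)\<^sup>2 \<le> (\<eta> * b)\<^sup>2"
        using a by (metis abs_ge_zero power2_abs power_mono)
      finally show "exp (- \<eta> * g k) \<le> 1 - \<eta> * g k + (\<eta> * b)\<^sup>2" by simp
    qed
    also have "\<dots> = (\<Sum>k\<in>S. w k) * (1 + (\<eta> * b)\<^sup>2) - \<eta> * m"
      by (simp add: m_def sum_distrib_left sum_distrib_right sum.distrib sum_subtractf algebra_simps)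
    also have "\<dots> = 1 + ((\<eta> * b)\<^sup>2 - \<eta> * m)" using w1 by simp
    finally have "ln D \<le> (\<eta> * b)\<^sup>2 - \<eta> * m"
      using D ln_add_one_self_le_self2[of "(\<eta> * b)\<^sup>2 - \<eta> * m"]
      by (smt (verit) ln_le_cancel_iff)
    then show ?thesis using zero_le_power2[of "\<eta> * b"] by linarith
  next
    case False
    have "D \<le> (\<Sum>k\<in>S. w k * exp (\<eta> * b))"
      unfolding D_def
    proof (intro sum_mono mult_left_mono w0)
      fix k assume k: "k \<in> S"
      have "\<eta> * (- g k) \<le> \<eta> * b" using assms(1) assms(4)[OF k] by (intro mult_left_mono) auto
      then show "exp (- \<eta> * g k) \<le> exp (\<eta> * b)" by simp
    qed
    also have "\<dots> = exp (\<eta> * b)" using w1 by (simp add: sum_distrib_right[symmetric])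
    finally have "ln D \<le> \<eta> * b" using D by (metis exp_gt_zero ln_exp ln_le_cancel_iff)
    moreover have "\<eta> * m \<le> \<eta> * b" using m_le assms by (intro mult_left_mono) auto
    moreover have "1 * (\<eta> * b) \<le> (\<eta> * b) * (\<eta> * b)"
      using False by (intro mult_right_mono) auto
    ultimately show ?thesis by (simp add: power2_eq_square)
  qed
  then have "(1/\<eta>) * ln D \<le> (1/\<eta>) * (- \<eta> * m + 2 * (\<eta> * b)\<^sup>2)"
    using assms by (intro mult_left_mono) auto
  also have "\<dots> = - m + 2 * \<eta> * b\<^sup>2"
    using assms by (simp add: field_simps power2_eq_square)
  finally show ?thesis unfolding diff using m_def w_def by simp
qed

section \<open>Adaptive learning rates\<close>

text \<open>Concavity: the tangent of \<open>sqrt\<close> at \<open>1 + c\<close>, evaluated at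
  \<open>c\<close>, lies above the graph. It telescopes the sum of \<open>1 / sqrt (1 + c)\<close>
  over the active rounds.\<close>

lemma sqrt_increment:
  assumes "0 \<le> (c::real)"
  shows "sqrt c + 1 / (2 * sqrt (1 + c)) \<le> sqrt (1 + c)"
proof -
  define s r where "s = sqrt (1 + c)" and "r = sqrt c"
  have s: "s > 0" "s\<^sup>2 = 1 + c" and r: "r\<^sup>2 = c" using assms by (auto simp: s_def r_def)
  have "2 * r * s \<le> r\<^sup>2 + s\<^sup>2" by (rule sum_squares_bound)
  then have "r * s * 2 + 1 \<le> 2 * (s * s)" using s r by (simp add: power2_eq_square)
  then show ?thesis using s(1) unfolding s_def[symmetric] r_def[symmetric]
    by (simp add: field_simps)
qed

text \<open>Inactive rounds have zero gradient, hence cost nothing; with \<open>c\<close> active rounds so far the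
  learning rate is of order \<open>1 / sqrt (1 + c)\<close> and the quadratic terms sum to order \<open>sqrt c\<close>.\<close>
lemma adaptive_EG_regret:
  fixes g G :: "nat \<Rightarrow> 'k \<Rightarrow> real" and C :: "nat \<Rightarrow> nat"
  assumes S: "finite S" "k \<in> S" and b: "0 < b"
    and G0: "G 0 = (\<lambda>_. 0)" and C0: "C 0 = 0"
    and G_Suc: "\<And>t j. t < n \<Longrightarrow> j \<in> S \<Longrightarrow> G (Suc t) j = G t j + g t j"
    and C_Suc: "\<And>t. t < n \<Longrightarrow> C (Suc t) = C t + (if act t then 1 else 0)"
    and inactive: "\<And>t j. t < n \<Longrightarrow> j \<in> S \<Longrightarrow> \<not> act t \<Longrightarrow> g t j = 0"
    and bound: "\<And>t j. t < n \<Longrightarrow> j \<in> S \<Longrightarrow> \<bar>g t j\<bar> \<le> b"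
  shows "(\<Sum>t<n. \<Sum>j\<in>S. gibbs (1 / b * sqrt (ln (card S) / (1 + real (C t)))) S (G t) j * g t j) - G n k
         \<le> 6 * b * sqrt (ln (card S)) * sqrt (C n)"
proof -
  define l where "l = sqrt (ln (real (card S)))"
  define \<eta> where "\<eta> c = 1 / b * sqrt (ln (real (card S)) / (1 + c))" for c :: real
  have ne: "S \<noteq> {}" using S by auto
  have N: "card S \<ge> 1" using S by (metis One_nat_def Suc_leI card_gt_0_iff ne)
  have G_le: "G n k = (\<Sum>t<n. g t k)"
  proof -
    have "m \<le> n \<Longrightarrow> G m k = (\<Sum>t<m. g t k)" for m
      by (induction m) (auto simp: G0 G_Suc S(2))
    then show ?thesis by simp
  qed
  show ?thesis
  \<comment> \<open>A single element gives \<open>ln (card S) = 0\<close>, hence rate 0, where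
    \<open>softmin\<close> divides by zero. In that case both sides of the claim are 0.\<close>
  proof (cases "card S = 1")
    case True
    then have S1: "S = {k}" using S(2) by (metis card_1_singletonE singletonD)
    have "gibbs \<eta> S (G t) j = 1" if "j \<in> S" for \<eta> t j
      using that unfolding S1 gibbs_def by simp
    then show ?thesis using True S1 G_le by simp
  next
    case False
    then have "card S \<ge> 2" using N by simp
    then have l: "l > 0" "l * l = ln (card S)" by (auto simp: l_def)
    have \<eta>_eq: "\<eta> c = l / (b * sqrt (1 + c))" for c
      by (simp add: \<eta>_def l_def real_sqrt_divide)
    have \<eta>_pos: "0 < \<eta> c" if "0 \<le> c" for c unfolding \<eta>_eq using l b that by simp
    have main: "(\<Sum>t<m. \<Sum>j\<in>S. gibbs (\<eta> (C t)) S (G t) j * g t j)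
          \<le> softmin (\<eta> (C m)) S (G m) + 4 * b * l * sqrt (C m)" if "m \<le> n" for m
      using that
    proof (induction m)
      case 0
      then show ?case using N by (simp add: softmin_def G0 C0)
    next
      case (Suc m)
      then have m: "m < n" by simp
      have G_eq: "softmin e S (G (Suc m)) = softmin e S (\<lambda>j. G m j + g m j)" for e
        unfolding softmin_def by (simp add: G_Suc[OF m])
      show ?case
      proof (cases "act m")
        case False
        then have "C (Suc m) = C m" using C_Suc[OF m] by simp
        moreover have "softmin e S (G (Suc m)) = softmin e S (G m)" for e
          unfolding softmin_def by (simp add: G_Suc[OF m] inactive[OF m _ False])
        ultimately show ?thesis using Suc by (simp add: inactive[OF m _ False])
      next
        case True
        then have C: "real (C (Suc m)) = 1 + C m" using C_Suc[OF m] by simp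
        \<comment> \<open>The step bound keeps the old rate on the new state; lowering the rate
          afterwards can only raise the potential.\<close>
        have "softmin (\<eta> (C m)) S (G (Suc m)) \<le> softmin (\<eta> (C (Suc m))) S (G (Suc m))"
          by (rule softmin_antimono) (use S ne l b in \<open>auto simp: \<eta>_eq C intro!: divide_left_mono\<close>)
        moreover have "(\<Sum>j\<in>S. gibbs (\<eta> (C m)) S (G m) j * g m j)
            \<le> softmin (\<eta> (C m)) S (G (Suc m)) - softmin (\<eta> (C m)) S (G m) + 2 * \<eta> (C m) * b\<^sup>2"
          unfolding G_eq by (rule softmin_step) (use S ne bound[OF m] \<eta>_pos in auto)
        moreover have "2 * \<eta> (C m) * b\<^sup>2 = 4 * b * l * (1 / (2 * sqrt (1 + C m)))"
          using b by (simp add: \<eta>_eq field_simps power2_eq_square)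
        moreover have "4 * b * l * (1 / (2 * sqrt (1 + C m))) \<le> 4 * b * l * (sqrt (1 + C m) - sqrt (C m))"
          using sqrt_increment[of "real (C m)"] b l by (intro mult_left_mono) auto
        ultimately show ?thesis using Suc.IH m unfolding C by (simp add: algebra_simps)
      qed
    qed
    show ?thesis
    \<comment> \<open>Without active rounds the estimate
      \<open>sqrt (1 + C n) \<le> 2 * sqrt (C n)\<close> below fails, but then all gradients
      vanish.\<close>
    proof (cases "C n = 0")
      case True
      have Cmono: "C t \<le> C n" if "t \<le> n" for t
        using that by (induction rule: inc_induct) (auto simp: C_Suc)
      have "\<not> act t" if "t < n" for t
        using Cmono[of "Suc t"] C_Suc[OF that] True that by auto
      then have "g t j = 0" if "t < n" "j \<in> S" for t j using inactive that by blast
      then show ?thesis using True G_le S by simp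
    next
      case False
      have "softmin (\<eta> (C n)) S (G n) \<le> G n k + ln (card S) / \<eta> (C n)"
        by (rule softmin_le) (use S \<eta>_pos in auto)
      also have "ln (card S) / \<eta> (C n) = b * l * sqrt (1 + C n)"
        unfolding l(2)[symmetric] \<eta>_eq using l b by (simp add: field_simps)
      also have "sqrt (1 + C n) \<le> sqrt (4 * C n)" using False by simp
      also have "\<dots> = 2 * sqrt (C n)" by (simp add: real_sqrt_mult)
      finally have "softmin (\<eta> (C n)) S (G n) \<le> G n k + b * l * (2 * sqrt (C n))"
        using b l by (simp add: mult_left_mono)
      \<comment> \<open>The constant 6 is 4 from the quadratic terms plus 2 from
        \<open>softmin_le\<close>.\<close>
      with main[of n] show ?thesis unfolding \<eta>_def l_def by simp
    qed
  qed
qed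

section \<open>Exponential concavity of the square loss\<close>

text \<open>The second derivative has the sign of \<open>2 * \<eta> * x\<^sup>2 - 1\<close>.\<close>

lemma exp_square_concave:
  fixes \<eta> r :: real
  assumes "0 < \<eta>" "2 * \<eta> * r\<^sup>2 \<le> 1"
  shows "concave_on {-r..r} (\<lambda>z. exp (- \<eta> * z\<^sup>2))"
proof (rule f''_le0_imp_concave)
  show "((\<lambda>z. exp (- \<eta> * z\<^sup>2)) has_real_derivative - 2 * \<eta> * x * exp (- \<eta> * x\<^sup>2)) (at x)" for x
    by (auto intro!: derivative_eq_intros)
  show "((\<lambda>x. - 2 * \<eta> * x * exp (- \<eta> * x\<^sup>2)) has_real_derivative
        (4 * \<eta>\<^sup>2 * x\<^sup>2 - 2 * \<eta>) * exp (- \<eta> * x\<^sup>2)) (at x)" for x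
    by (auto intro!: derivative_eq_intros simp: algebra_simps power2_eq_square)
  show "(4 * \<eta>\<^sup>2 * x\<^sup>2 - 2 * \<eta>) * exp (- \<eta> * x\<^sup>2) \<le> 0" if "x \<in> {-r..r}" for x
  proof -
    have "x\<^sup>2 \<le> r\<^sup>2" using that by (intro power2_le_iff_abs_le[THEN iffD2]) auto
    then have "2 * \<eta> * x\<^sup>2 \<le> 2 * \<eta> * r\<^sup>2" using assms by (intro mult_left_mono) auto
    then have "2 * \<eta> * (2 * \<eta> * x\<^sup>2) \<le> 2 * \<eta> * 1"
      using assms by (intro mult_left_mono) linarith+
    then have "4 * \<eta>\<^sup>2 * x\<^sup>2 - 2 * \<eta> \<le> 0" by (simp add: power2_eq_square algebra_simps)
    then show ?thesis by (simp add: mult_nonpos_nonneg)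
  qed
qed auto

text \<open>By concavity the loss of the averaged prediction is at most the increase of the
  potential, with no quadratic remainder. Hence a fixed rate suffices and the regret does not grow
  with the number of rounds.\<close>

lemma exp_weights_regret:
  fixes f :: "nat \<Rightarrow> 'k \<Rightarrow> real" and y :: "nat \<Rightarrow> real" and L :: "nat \<Rightarrow> 'k \<Rightarrow> real"
  assumes S: "finite S" "k \<in> S" and \<eta>: "0 < \<eta>" "2 * \<eta> * r\<^sup>2 \<le> 1"
    and L0: "L 0 = (\<lambda>_. 0)"
    and L_Suc: "\<And>t j. t < n \<Longrightarrow> j \<in> S \<Longrightarrow> L (Suc t) j = L t j + (if act t then (y t - f t j)\<^sup>2 else 0)"
    and bound: "\<And>t j. t < n \<Longrightarrow> act t \<Longrightarrow> j \<in> S \<Longrightarrow> \<bar>y t - f t j\<bar> \<le> r"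
  shows "(\<Sum>t<n. if act t then (y t - (\<Sum>j\<in>S. gibbs \<eta> S (L t) j * f t j))\<^sup>2 else 0)
         \<le> L n k + ln (card S) / \<eta>"
proof -
  have ne: "S \<noteq> {}" using S by auto
  have N: "real (card S) > 0" using S by (auto simp: card_gt_0_iff)
  have "(\<Sum>t<m. if act t then (y t - (\<Sum>j\<in>S. gibbs \<eta> S (L t) j * f t j))\<^sup>2 else 0)
        \<le> softmin \<eta> S (L m)" if "m \<le> n" for m
    using that
  proof (induction m)
    case 0
    then show ?case using N by (simp add: softmin_def L0)
  next
    case (Suc m)
    then have m: "m < n" by simp
    show ?case
    proof (cases "act m")
      case False
      then have "softmin \<eta> S (L (Suc m)) = softmin \<eta> S (L m)"
        unfolding softmin_def by (simp add: L_Suc[OF m])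
      then show ?thesis using Suc False by simp
    next
      case True
      define w where "w = gibbs \<eta> S (L m)"
      define Z where "Z = (\<Sum>j\<in>S. exp (- \<eta> * L m j))"
      define Z' where "Z' = (\<Sum>j\<in>S. exp (- \<eta> * L (Suc m) j))"
      have Z: "Z > 0" "Z' > 0" unfolding Z_def Z'_def by (intro sum_exp_pos S ne)+
      have w1: "(\<Sum>j\<in>S. w j) = 1" unfolding w_def by (rule sum_gibbs[OF S(1) ne])
      define u where "u = y m - (\<Sum>j\<in>S. w j * f m j)"
      have u: "u = (\<Sum>j\<in>S. w j *\<^sub>R (y m - f m j))"
        using w1 by (simp add: u_def right_diff_distrib sum_subtractf sum_distrib_right[symmetric])
      \<comment> \<open>The ratio of normalisers is the average of
        \<open>exp (- \<eta> * z\<^sup>2)\<close> over the residuals \<open>z\<close> of the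
        experts, and \<open>u\<close> is the average residual: Jensen applies.\<close>
      have "Z' / Z = (\<Sum>j\<in>S. w j * exp (- \<eta> * (y m - f m j)\<^sup>2))"
        using True by (simp add: Z'_def Z_def w_def gibbs_def sum_divide_distrib L_Suc[OF m]
            distrib_left exp_add[symmetric])
      also have "\<dots> \<le> exp (- \<eta> * u\<^sup>2)"
        unfolding u using bound[OF m True]
        by (intro concave_on_sum[OF S(1) ne exp_square_concave[OF \<eta>]])
          (auto simp: w1[unfolded w_def] w_def gibbs_nonneg abs_le_iff algebra_simps)
      finally have "ln (Z' / Z) \<le> - \<eta> * u\<^sup>2"
        using Z by (metis divide_pos_pos exp_gt_zero ln_exp ln_le_cancel_iff)
      then have "u\<^sup>2 \<le> - (1 / \<eta>) * ln (Z' / Z)"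
        using \<eta> by (simp add: field_simps)
      also have "ln (Z' / Z) = ln (Z' / card S) - ln (Z / card S)"
        using Z N by (simp add: ln_div)
      also have "- (1 / \<eta>) * \<dots> = softmin \<eta> S (L (Suc m)) - softmin \<eta> S (L m)"
        by (simp add: softmin_def Z_def Z'_def algebra_simps)
      finally show ?thesis using Suc True by (simp add: u_def w_def)
    qed
  qed
  from this[of n] softmin_le[OF \<eta>(1) S, of "L n"] show ?thesis by simp
qed

section \<open>Nested cells and Taylor approximation\<close>

lemma abs_clip_le: "0 \<le> c \<Longrightarrow> \<bar>clip c v\<bar> \<le> c"
  by (auto simp: clip_def)

lemma clip_eq: "\<bar>v\<bar> \<le> c \<Longrightarrow> clip c v = v"
  by (auto simp: clip_def)

lemma abs_clip_diff_le: "\<bar>v\<bar> \<le> c \<Longrightarrow> \<bar>clip c u - v\<bar> \<le> \<bar>u - v\<bar>"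
  by (auto simp: clip_def)

text \<open>In the coordinate \<open>(x * Nx - (a - 1)) * 4 ^ m\<close> subcells are unit intervals
  with integer ends, so membership is a floor computation and passing to the parent is division by
  4.\<close>

lemma in_sub_iff:
  assumes "0 < Nx"
  shows "in_sub Nx a m n x \<longleftrightarrow>
    real (n - 1) \<le> (x * real Nx - real (a - 1)) * 4 ^ m \<and>
    ((x * real Nx - real (a - 1)) * 4 ^ m < real (n - 1) + 1 \<or> a = Nx \<and> n = 4 ^ m \<and> x = 1)"
proof -
  have pos: "real Nx * 4 ^ m > 0" using assms by simp
  have "sub_lo Nx a m n = (real (a - 1) * 4 ^ m + real (n - 1)) / (real Nx * 4 ^ m)"
    using assms unfolding sub_lo_def by (simp add: field_simps)
  moreover have "(real (a - 1) * 4 ^ m + real (n - 1)) / (real Nx * 4 ^ m) + 1 / (real Nx * 4 ^ m)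
      = (real (a - 1) * 4 ^ m + real (n - 1) + 1) / (real Nx * 4 ^ m)"
    by (simp add: add_divide_distrib)
  ultimately show ?thesis
    unfolding in_sub_def using pos
    by (simp add: pos_divide_le_eq pos_less_divide_eq) (simp add: algebra_simps)
qed

text \<open>Level 0 has a single subcell, the cell itself; this makes the base class the root of the
  tree.\<close>

lemma P0_eq_Pmn: "P0 B q Nx Ny a = Pmn B q Nx Ny a 0 1" if "1 \<le> a" "0 < Nx"
  using that by (simp add: P0_def Pmn_def cell_center_def sub_center_def sub_lo_def of_nat_diff diff_divide_distrib)

lemma in_cell_exists:
  assumes "0 < Nx" "x \<in> {0..1}"
  shows "\<exists>a\<in>{1..Nx}. in_cell Nx a x"
proof (cases "x = 1")
  case True
  then show ?thesis using assms by (intro bexI[of _ Nx]) (auto simp: in_cell_def)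
next
  case False
  define k where "k = nat \<lfloor>x * real Nx\<rfloor>"
  have k: "real k \<le> x * real Nx" "x * real Nx < real k + 1"
    using assms by (auto simp: k_def)
  have "x * real Nx < 1 * real Nx" using assms False by (intro mult_strict_right_mono) auto
  with k have "real k < real Nx" by linarith
  then show ?thesis using k assms
    by (intro bexI[of _ "k + 1"]) (auto simp: in_cell_def field_simps)
qed

lemma in_cell_unique:
  assumes "0 < Nx" "x \<le> 1" "a \<in> {1..Nx}" "a' \<in> {1..Nx}" "in_cell Nx a x" "in_cell Nx a' x"
  shows "a = a'"
proof -
  have le: "a \<le> a'" if "a \<in> {1..Nx}" "a' \<in> {1..Nx}" "in_cell Nx a x" "in_cell Nx a' x" for a a'
  proof -
    have "real (a - 1) \<le> x * real Nx" using that assms by (simp add: in_cell_def field_simps)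
    moreover have "x * real Nx < real a' \<or> a' = Nx"
      using that assms by (auto simp: in_cell_def field_simps)
    ultimately show ?thesis using that by auto
  qed
  show ?thesis using le[of a a'] le[of a' a] assms by simp
qed

lemma in_cell_coordinate:
  assumes "0 < Nx" "1 \<le> a" "in_cell Nx a x"
  shows "0 \<le> x * real Nx - real (a - 1)"
    and "x * real Nx - real (a - 1) < 1 \<or> a = Nx \<and> x = 1"
  using assms by (auto simp: in_cell_def field_simps of_nat_diff)

lemma in_sub_exists:
  assumes "0 < Nx" "1 \<le> a" "in_cell Nx a x"
  shows "\<exists>n\<in>{1..4 ^ m}. in_sub Nx a m n x"
proof (cases "a = Nx \<and> x = 1")
  case True
  then show ?thesis using assms
    by (intro bexI[of _ "4 ^ m"]) (auto simp: in_sub_iff of_nat_diff)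
next
  case False
  define u where "u = (x * real Nx - real (a - 1)) * 4 ^ m"
  define k where "k = nat \<lfloor>u\<rfloor>"
  have "0 \<le> u" "u < 4 ^ m" using in_cell_coordinate[OF assms] False by (auto simp: u_def)
  then have k: "real k \<le> u" "u < real k + 1" by (auto simp: k_def)
  with \<open>u < 4 ^ m\<close> have "real k < 4 ^ m" by linarith
  then have "k < 4 ^ m" by (metis of_nat_less_iff of_nat_numeral of_nat_power)
  then show ?thesis using k assms
    by (intro bexI[of _ "k + 1"]) (auto simp: in_sub_iff u_def)
qed

lemma in_sub_unique:
  assumes "0 < Nx" "1 \<le> a" "in_cell Nx a x" "n \<in> {1..4 ^ m}" "n' \<in> {1..4 ^ m}"
    "in_sub Nx a m n x" "in_sub Nx a m n' x"
  shows "n = n'"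
proof -
  have le: "n \<le> n'" if "n \<in> {1..4 ^ m}" "n' \<in> {1..4 ^ m}" "in_sub Nx a m n x" "in_sub Nx a m n' x" for n n'
  proof -
    have "real (n - 1) < real (n' - 1) + 1 \<or> n' = 4 ^ m"
      using that assms(1) by (auto simp: in_sub_iff)
    then show ?thesis using that by auto
  qed
  show ?thesis using le[of n n'] le[of n' n] assms by simp
qed

lemma parent_range:
  assumes "n \<in> {1..4 ^ Suc m}"
  shows "parent n \<in> {1..4 ^ m}"
  using assms by (auto simp: parent_def)

lemma in_sub_parent:
  assumes "0 < Nx" "n \<in> {1..4 ^ Suc m}" "in_sub Nx a (Suc m) n x"
  shows "in_sub Nx a m (parent n) x"
proof -
  define u where "u = (x * real Nx - real (a - 1)) * 4 ^ m"
  define k where "k = (n - 1) div 4"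
  have k: "4 * k \<le> n - 1" "n - 1 \<le> 4 * k + 3" by (auto simp: k_def)
  have u4: "(x * real Nx - real (a - 1)) * 4 ^ Suc m = 4 * u" by (simp add: u_def)
  have "real (n - 1) \<le> 4 * u" "4 * u < real (n - 1) + 1 \<or> a = Nx \<and> n = 4 ^ Suc m \<and> x = 1"
    using assms(3) unfolding in_sub_iff[OF assms(1)] u4 by auto
  \<comment> \<open>The closed right end at 1 passes from the last subcell to the last parent:
    \<open>(4 ^ Suc m - 1) div 4 = 4 ^ m - 1\<close>.\<close>
  moreover have "k + 1 = 4 ^ m" if "n = 4 ^ Suc m"
  proof -
    obtain K where "4 ^ m = Suc K" using not0_implies_Suc[of "4 ^ m"] by auto
    then show ?thesis using that by (simp add: k_def)
  qed
  ultimately have "real k \<le> u" "u < real k + 1 \<or> a = Nx \<and> k + 1 = 4 ^ m \<and> x = 1"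
    using k by auto
  then show ?thesis unfolding in_sub_iff[OF assms(1)] parent_def u_def k_def by simp
qed

lemma dist_sub_center_le:
  assumes "0 < Nx" "1 \<le> n" "1 \<le> a" "in_sub Nx a m n x"
  shows "\<bar>x - sub_center Nx a m n\<bar> \<le> 1 / (2 * real Nx) / 4 ^ m"
proof -
  define h where "h = 1 / (2 * real Nx) / (4 ^ m :: real)"
  have h: "1 / (real Nx * 4 ^ m) = 2 * h" "1 / (2 * real Nx * 4 ^ m) = h"
    by (auto simp: h_def)
  have "x < sub_lo Nx a m n + 2 * h \<or> x = sub_lo Nx a m n + 2 * h"
  proof (cases "a = Nx \<and> n = 4 ^ m \<and> x = 1")
    case True
    then show ?thesis using assms h(1)[symmetric] by (simp add: sub_lo_def of_nat_diff field_simps)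
  next
    case False
    then show ?thesis using assms(4) unfolding in_sub_def h by auto
  qed
  moreover have "sub_lo Nx a m n \<le> x" using assms(4) by (auto simp: in_sub_def)
  ultimately show ?thesis unfolding sub_center_def h h_def[symmetric] by auto
qed

lemma sub_center_in_unit:
  assumes "a \<in> {1..Nx}" "n \<in> {1..4 ^ m}"
  shows "sub_center Nx a m n \<in> {0..1}"
proof -
  have pos: "real Nx * 4 ^ m > 0" using assms by simp
  have n: "real n \<le> 4 ^ m" using assms by (metis atLeastAtMost_iff of_nat_le_iff of_nat_numeral of_nat_power)
  define N where "N = (real a - 1) * 4 ^ m + (real n - 1/2)"
  have "sub_center Nx a m n = ((real a - 1) * 4 ^ m + (real n - 1/2)) / (real Nx * 4 ^ m)"
    using assms unfolding sub_center_def sub_lo_def by (simp add: field_simps of_nat_diff)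
  moreover have "(real a - 1) * 4 ^ m \<le> (real Nx - 1) * 4 ^ m"
    using assms by (intro mult_right_mono) auto
  moreover have "0 \<le> (real a - 1) * 4 ^ m" using assms by simp
  moreover have "(real Nx - 1) * 4 ^ m = real Nx * 4 ^ m - 4 ^ m" by (simp add: left_diff_distrib)
  moreover have "1 \<le> real n" using assms by simp
  ultimately have "sub_center Nx a m n = N / (real Nx * 4 ^ m)" "0 \<le> N" "N \<le> real Nx * 4 ^ m"
    using n unfolding N_def by (fast, linarith, linarith)
  then show ?thesis using pos by (simp add: divide_le_eq_1)
qed

section \<open>Taylor remainder with a Hoelder top derivative\<close>

text \<open>The derivative of the remainder is the remainder, one order lower, of the shifted family
  \<open>\<lambda>k. D (Suc k)\<close>, and the derivative of the bound is the bound one order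
  lower. So \<open>V - R\<close> and \<open>V + R\<close> increase from 0. Only the oscillation of
  the top derivative enters; it is never differentiated.\<close>

lemma taylor_remainder_unit:
  fixes D :: "nat \<Rightarrow> real \<Rightarrow> real"
  assumes "\<And>k s. k < q \<Longrightarrow> s \<in> {0..1} \<Longrightarrow> (D k has_real_derivative D (Suc k) s) (at s within {0..1})"
    and "\<And>s. s \<in> {0..1} \<Longrightarrow> \<bar>D q s - D q 0\<bar> \<le> K"
    and "s \<in> {0..1}"
  shows "\<bar>D 0 s - (\<Sum>i\<le>q. D i 0 / fact i * s ^ i)\<bar> \<le> K * s ^ q / fact q"
  using assms
proof (induction q arbitrary: D s)
  case 0
  then show ?case by simp
next
  case (Suc q)
  define R where "R t = D 0 t - (\<Sum>i\<le>Suc q. D i 0 / fact i * t ^ i)" for t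
  define R' where "R' t = D 1 t - (\<Sum>i\<le>q. D (Suc i) 0 / fact i * t ^ i)" for t
  define V where "V t = K * t ^ Suc q / fact (Suc q)" for t
  have R'_le: "\<bar>R' t\<bar> \<le> K * t ^ q / fact q" if "t \<in> {0..1}" for t
    using Suc.IH[of "\<lambda>k. D (Suc k)" t] Suc.prems that by (simp add: R'_def)
  have dR: "(R has_real_derivative R' t) (at t within {0..1})" if "t \<in> {0..1}" for t
  proof -
    have "((\<lambda>t. \<Sum>i\<le>Suc q. D i 0 / fact i * t ^ i) has_real_derivative
          (\<Sum>i\<le>Suc q. D i 0 / fact i * (real i * t ^ (i - 1)))) (at t within {0..1})"
      by (rule DERIV_sum) (auto intro!: derivative_eq_intros)
    also have "(\<Sum>i\<le>Suc q. D i 0 / fact i * (real i * t ^ (i - 1))) = (\<Sum>i\<le>q. D (Suc i) 0 / fact i * t ^ i)"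
      unfolding sum.atMost_Suc_shift by (simp add: field_simps del: of_nat_Suc)
    finally show ?thesis
      unfolding R_def R'_def using Suc.prems(1)[of 0 t] that by (auto intro!: DERIV_diff)
  qed
  have dV: "(V has_real_derivative K * t ^ q / fact q) (at t within {0..1})" for t
  proof -
    have "((\<lambda>t. K / fact (Suc q) * t ^ Suc q) has_real_derivative
          K / fact (Suc q) * (real (Suc q) * t ^ (Suc q - Suc 0))) (at t within {0..1})"
      by (intro DERIV_cmult DERIV_pow)
    moreover have "K / fact (Suc q) * (real (Suc q) * t ^ (Suc q - Suc 0)) = K * t ^ q / fact q"
      by (simp add: divide_simps del: of_nat_Suc)
    ultimately show ?thesis unfolding V_def by simp
  qed
  have mono: "0 \<le> F s" if F: "\<And>t. t \<in> {0..1} \<Longrightarrow> (F has_real_derivative F' t) (at t within {0..1})"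
    "\<And>t. t \<in> {0..1} \<Longrightarrow> 0 \<le> F' t" "F 0 = 0" for F F' :: "real \<Rightarrow> real"
  proof -
    have "F 0 \<le> F s"
    proof (rule DERIV_nonneg_imp_increasing_open[where f = F and a = 0 and b = s])
      show "\<exists>y. DERIV F x :> y \<and> y \<ge> 0" if "0 < x" "x < s" for x
        using F(1,2)[of x] that Suc.prems(3) by (auto simp: at_within_Icc_at)
      show "continuous_on {0..s} F"
        using Suc.prems(3)
        by (intro continuous_on_subset[OF DERIV_continuous_on[OF F(1)]]) auto
    qed (use Suc.prems(3) in auto)
    then show ?thesis using F(3) by simp
  qed
  have R0: "R 0 = 0" unfolding R_def sum.atMost_Suc_shift by simp
  have V0: "V 0 = 0" by (simp add: V_def)
  have "0 \<le> V s - R s"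
  proof (rule mono)
    show "((\<lambda>t. V t - R t) has_real_derivative K * t ^ q / fact q - R' t) (at t within {0..1})"
      if "t \<in> {0..1}" for t
      by (intro DERIV_diff dV dR that)
    show "0 \<le> K * t ^ q / fact q - R' t" if "t \<in> {0..1}" for t
      using R'_le[OF that] by linarith
  qed (simp add: R0 V0)
  moreover have "0 \<le> V s + R s"
  proof (rule mono)
    show "((\<lambda>t. V t + R t) has_real_derivative K * t ^ q / fact q + R' t) (at t within {0..1})"
      if "t \<in> {0..1}" for t
      by (intro DERIV_add dV dR that)
    show "0 \<le> K * t ^ q / fact q + R' t" if "t \<in> {0..1}" for t
      using R'_le[OF that] by linarith
  qed (simp add: R0 V0)
  ultimately show ?case unfolding R_def[symmetric] V_def[symmetric] by linarith
qed

text \<open>Parametrising the segment from \<open>c\<close> to \<open>x\<close> by the unit interval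
  treats both sides of \<open>c\<close> at once and stays inside the domain of the
  derivatives.\<close>

lemma taylor_remainder_le:
  fixes D :: "nat \<Rightarrow> real \<Rightarrow> real"
  assumes D: "\<And>k x. k < q \<Longrightarrow> x \<in> {0..1} \<Longrightarrow> (D k has_real_derivative D (Suc k) x) (at x within {0..1})"
    and H: "\<And>x y. x \<in> {0..1} \<Longrightarrow> y \<in> {0..1} \<Longrightarrow> \<bar>D q x - D q y\<bar> \<le> lam * \<bar>x - y\<bar> powr \<alpha>"
    and "0 < lam" "0 < \<alpha>" and c: "c \<in> {0..1}" and x: "x \<in> {0..1}"
  shows "\<bar>D 0 x - (\<Sum>i\<le>q. D i c / fact i * (x - c) ^ i)\<bar>
         \<le> lam / fact q * (\<bar>x - c\<bar> ^ q * \<bar>x - c\<bar> powr \<alpha>)"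
proof -
  define h where "h = x - c"
  define E where "E k s = D k (c + s * h) * h ^ k" for k s
  have seg: "c + s * h \<in> {0..1}" if "s \<in> {0..1}" for s
  proof -
    have "(1 - s) *\<^sub>R c + s *\<^sub>R x \<in> {0..1::real}"
      using convex_real_interval(5)[of 0 1] c x that by (intro convexD) auto
    then show ?thesis by (simp add: h_def algebra_simps)
  qed
  have "\<bar>E 0 1 - (\<Sum>i\<le>q. E i 0 / fact i * 1 ^ i)\<bar> \<le> (lam * \<bar>h\<bar> powr \<alpha> * \<bar>h\<bar> ^ q) * 1 ^ q / fact q"
  proof (rule taylor_remainder_unit)
    fix k and s :: real assume k: "k < q" and s: "s \<in> {0..1}"
    have "(D k has_real_derivative D (Suc k) (c + s * h)) (at (c + s * h) within (\<lambda>s. c + s * h) ` {0..1})"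
      by (rule DERIV_subset[OF D[OF k seg[OF s]]]) (use seg in auto)
    then have "(D k \<circ> (\<lambda>s. c + s * h) has_real_derivative D (Suc k) (c + s * h) * h) (at s within {0..1})"
      by (rule DERIV_image_chain) (auto intro!: derivative_eq_intros)
    from DERIV_cmult_right[OF this, of "h ^ k"]
    show "(E k has_real_derivative E (Suc k) s) (at s within {0..1})"
      by (simp add: E_def[abs_def] o_def mult_ac)
  next
    fix s :: real assume s: "s \<in> {0..1}"
    have "\<bar>D q (c + s * h) - D q (c + 0 * h)\<bar> \<le> lam * \<bar>s * h\<bar> powr \<alpha>"
      using H[OF seg[OF s] c] by simp
    also have "\<dots> \<le> lam * \<bar>h\<bar> powr \<alpha>"
      using s assms by (intro mult_left_mono powr_mono2) (auto simp: abs_mult mult_left_le_one_le)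
    finally show "\<bar>E q s - E q 0\<bar> \<le> lam * \<bar>h\<bar> powr \<alpha> * \<bar>h\<bar> ^ q"
      unfolding E_def left_diff_distrib[symmetric] abs_mult power_abs by (rule mult_right_mono) simp
  qed simp
  then show ?thesis by (simp add: E_def h_def mult_ac)
qed

section \<open>Quantised Taylor polynomials\<close>

text \<open>Source of the factor \<open>exp 1\<close> in the grid step: an error
  \<open>\<epsilon>\<close> in every derivative value costs at most
  \<open>\<epsilon> * exp 1\<close> at distance at most 1 from the centre.\<close>

lemma sum_power_fact_le_exp:
  assumes "0 \<le> (r::real)"
  shows "(\<Sum>i\<le>q. r ^ i / fact i) \<le> exp r"
proof -
  have "(\<Sum>i\<in>{..q}. r ^ i /\<^sub>R fact i) \<le> (\<Sum>i. r ^ i /\<^sub>R fact i)"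
    by (intro sum_le_suminf summable_exp_generic) (use assms in auto)
  then show ?thesis by (simp add: exp_def field_simps)
qed

text \<open>Both \<open>- B\<close> and \<open>B\<close> are grid points, so rounding to the nearest
  one never leaves the grid and costs half a step.\<close>

lemma grid_rounding:
  assumes "0 < B" "0 < Ny" "\<bar>v\<bar> \<le> B"
  shows "\<exists>g\<in>grid B Ny m. \<bar>g - v\<bar> \<le> B / real Ny / 2 ^ m"
proof -
  define h where "h = 2 * B / real Ny / 2 ^ m"
  have h: "h > 0" using assms by (simp add: h_def)
  define u where "u = (v + B) / h"
  define j where "j = nat (round u)"
  have "0 \<le> u" using assms h by (simp add: u_def)
  then have "0 \<le> round u" using round_mono[of 0 u] by simp
  then have j: "real j = of_int (round u)" by (simp add: j_def)
  have "v + B \<le> 2 * B" using assms by linarith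
  then have "u \<le> real (2 ^ m * Ny)" using assms h by (simp add: u_def h_def field_simps)
  then have "round u \<le> int (2 ^ m * Ny)" by (metis round_mono round_of_nat)
  then have "j \<le> 2 ^ m * Ny" unfolding j_def by linarith
  moreover have "\<bar>- B + real j * h - v\<bar> \<le> h / 2"
  proof -
    have "\<bar>real j - u\<bar> * h \<le> 1 / 2 * h"
      using of_int_round_abs_le[of u] h unfolding j by (intro mult_right_mono) auto
    moreover have "- B + real j * h - v = (real j - u) * h" using h by (simp add: u_def field_simps)
    ultimately show ?thesis using h by (simp add: abs_mult)
  qed
  ultimately show ?thesis
    by (intro bexI[of _ "- B + real j * h"]) (auto simp: grid_def h_def)
qed

text \<open>Half of the allowed error goes to the Taylor remainder, half to rounding the coefficients;
  passing from level \<open>m\<close> to \<open>m + 1\<close> divides cell lengths by 4, hence the remainder by \<open>4 powr \<beta> \<ge> 2\<close>.\<close>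
lemma holder_class_approx:
  assumes f: "f \<in> holder_class q B lam \<alpha>" and B: "0 < B" and Ny: "0 < Ny"
    and a: "a \<in> {1..Nx}" and n: "n \<in> {1..4 ^ m}"
    and lam: "0 < lam" and \<alpha>: "0 < \<alpha>" "real q + \<alpha> \<ge> 1/2"
    and hx: "lam / fact q * (1 / (2 * real Nx)) powr (real q + \<alpha>) \<le> gam / 2"
    and hy: "2 * B / real Ny \<le> gam / exp 1"
  shows "\<exists>P\<in>Pmn B q Nx Ny a m n. \<forall>x\<in>{0..1}. in_sub Nx a m n x \<longrightarrow> \<bar>P x - f x\<bar> \<le> gam / 2 ^ m"
proof -
  from f obtain D where *: "\<forall>x\<in>{0..1}. D 0 x = f x"
      "\<forall>k<q. \<forall>x\<in>{0..1}. (D k has_real_derivative D (Suc k) x) (at x within {0..1})"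
      "\<forall>k\<le>q. \<forall>x\<in>{0..1}. \<bar>D k x\<bar> \<le> B"
      "\<forall>x\<in>{0..1}. \<forall>y\<in>{0..1}. \<bar>D q x - D q y\<bar> \<le> lam * \<bar>x - y\<bar> powr \<alpha>"
    unfolding holder_class_def mem_Collect_eq by (elim exE conjE) (rule that)
  have D0: "D 0 x = f x" if "x \<in> {0..1}" for x
    using *(1) that by (rule bspec)
  have D: "(D k has_real_derivative D (Suc k) x) (at x within {0..1})" if "k < q" "x \<in> {0..1}" for k x
    using *(2)[rule_format, OF that] .
  have D_le: "\<bar>D k x\<bar> \<le> B" if "k \<le> q" "x \<in> {0..1}" for k x
    using *(3)[rule_format, OF that] .
  have H: "\<bar>D q x - D q y\<bar> \<le> lam * \<bar>x - y\<bar> powr \<alpha>" if "x \<in> {0..1}" "y \<in> {0..1}" for x y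
    using *(4)[rule_format, OF that] .
  define c where "c = sub_center Nx a m n"
  have c: "c \<in> {0..1}" unfolding c_def by (rule sub_center_in_unit[OF a n])
  have Nx: "0 < Nx" using a by auto
  have "\<forall>i\<in>{..q}. \<exists>g. g \<in> grid B Ny m \<and> \<bar>g - D i c\<bar> \<le> B / real Ny / 2 ^ m"
    using grid_rounding[OF B Ny D_le[OF _ c]] by (meson atMost_iff)
  from bchoice[OF this] obtain cs where cs: "\<And>i. i \<le> q \<Longrightarrow> cs i \<in> grid B Ny m"
    "\<And>i. i \<le> q \<Longrightarrow> \<bar>cs i - D i c\<bar> \<le> B / real Ny / 2 ^ m" by blast
  show ?thesis
  proof (intro bexI ballI impI)
    show "taylor_poly B q c cs \<in> Pmn B q Nx Ny a m n"
      unfolding Pmn_def poly_class_def c_def[symmetric] using cs(1) by blast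
    fix x :: real assume x: "x \<in> {0..1}" and sub: "in_sub Nx a m n x"
    define r where "r = \<bar>x - c\<bar>"
    have r: "0 \<le> r" "r \<le> 1 / (2 * real Nx) / 4 ^ m"
      using dist_sub_center_le[OF Nx _ _ sub] n a by (auto simp: r_def c_def)
    have r1: "r \<le> 1" using x c by (auto simp: r_def)
    have rem: "\<bar>D 0 x - (\<Sum>i\<le>q. D i c / fact i * (x - c) ^ i)\<bar> \<le> gam / 2 / 2 ^ m"
    proof -
      have "r ^ q * r powr \<alpha> \<le> (1 / (2 * real Nx)) powr (real q + \<alpha>) * (1 / 2 ^ m)"
      proof (cases "r = 0")
        case False
        then have "r ^ q * r powr \<alpha> = r powr (real q + \<alpha>)"
          using r by (simp add: powr_add powr_realpow)
        also have "\<dots> \<le> (1 / (2 * real Nx) / 4 ^ m) powr (real q + \<alpha>)"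
          using r \<alpha> by (intro powr_mono2) auto
        also have "\<dots> = (1 / (2 * real Nx)) powr (real q + \<alpha>) / (4 ^ m) powr (real q + \<alpha>)"
          by (rule powr_divide)
        also have "\<dots> \<le> (1 / (2 * real Nx)) powr (real q + \<alpha>) / 2 ^ m"
        proof (intro divide_left_mono)
          have "(2::real) ^ m = sqrt ((2 ^ m)\<^sup>2)" by simp
          also have "\<dots> = sqrt (4 ^ m)" by (simp add: power2_eq_square power_mult_distrib[symmetric])
          also have "\<dots> = (4 ^ m) powr (1/2)" by (simp add: powr_half_sqrt)
          also have "\<dots> \<le> (4 ^ m) powr (real q + \<alpha>)" using \<alpha> by (intro powr_mono) auto
          finally show "(2::real) ^ m \<le> (4 ^ m) powr (real q + \<alpha>)" .
        qed auto
        finally show ?thesis by simp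
      qed simp
      then have "lam / fact q * (r ^ q * r powr \<alpha>)
          \<le> lam / fact q * ((1 / (2 * real Nx)) powr (real q + \<alpha>) * (1 / 2 ^ m))"
        using lam by (intro mult_left_mono) auto
      also have "\<dots> \<le> gam / 2 * (1 / 2 ^ m)"
        unfolding mult.assoc[symmetric] by (rule mult_right_mono[OF hx]) simp
      finally show ?thesis
        using taylor_remainder_le[OF D H lam \<alpha>(1) c x] unfolding r_def[symmetric] by simp
    qed
    have "\<bar>(\<Sum>i\<le>q. cs i / fact i * (x - c) ^ i) - (\<Sum>i\<le>q. D i c / fact i * (x - c) ^ i)\<bar>
        = \<bar>\<Sum>i\<le>q. (cs i - D i c) * ((x - c) ^ i / fact i)\<bar>"
      by (simp add: sum_subtractf[symmetric] left_diff_distrib diff_divide_distrib)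
    also have "\<dots> \<le> (\<Sum>i\<le>q. B / real Ny / 2 ^ m * (r ^ i / fact i))"
    proof (rule order_trans[OF sum_abs sum_mono])
      fix i assume "i \<in> {..q}"
      then have "\<bar>cs i - D i c\<bar> * (r ^ i / fact i) \<le> B / real Ny / 2 ^ m * (r ^ i / fact i)"
        using r(1) by (intro mult_right_mono cs(2)) auto
      then show "\<bar>(cs i - D i c) * ((x - c) ^ i / fact i)\<bar> \<le> B / real Ny / 2 ^ m * (r ^ i / fact i)"
        by (simp add: abs_mult r_def power_abs)
    qed
    also have "\<dots> = B / real Ny / 2 ^ m * (\<Sum>i\<le>q. r ^ i / fact i)" by (rule sum_distrib_left[symmetric])
    also have "\<dots> \<le> B / real Ny / 2 ^ m * exp 1"
      using sum_power_fact_le_exp[OF r(1), of q] r1 B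
      by (intro mult_left_mono) (auto intro: order_trans)
    also have "\<dots> \<le> gam / 2 / 2 ^ m" using hy by (simp add: field_simps)
    finally have round: "\<bar>(\<Sum>i\<le>q. cs i / fact i * (x - c) ^ i) - (\<Sum>i\<le>q. D i c / fact i * (x - c) ^ i)\<bar>
        \<le> gam / 2 / 2 ^ m" .
    have "gam / 2 / 2 ^ m + gam / 2 / 2 ^ m = gam / 2 ^ m" by (simp add: field_simps)
    with round rem have "\<bar>(\<Sum>i\<le>q. cs i / fact i * (x - c) ^ i) - D 0 x\<bar> \<le> gam / 2 ^ m"
      by linarith
    \<comment> \<open>Clipping cannot move the value away from \<open>f x\<close>, which already
      lies between \<open>- B\<close> and \<open>B\<close>.\<close>
    moreover have "\<bar>taylor_poly B q c cs x - f x\<bar> \<le> \<bar>(\<Sum>i\<le>q. cs i / fact i * (x - c) ^ i) - f x\<bar>"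
      unfolding taylor_poly_def using D_le[of 0 x] D0[OF x] x by (intro abs_clip_diff_le) simp
    ultimately show "\<bar>taylor_poly B q c cs x - f x\<bar> \<le> gam / 2 ^ m" using D0[OF x] by simp
  qed
qed

section \<open>The function classes\<close>

lemma grid_eq_image: "grid B Ny m = (\<lambda>j. - B + real j * (2 * B / real Ny) / 2 ^ m) ` {..2 ^ m * Ny}"
  by (auto simp: grid_def)

lemma card_grid_le: "card (grid B Ny m) \<le> 2 ^ m * Ny + 1"
  unfolding grid_eq_image using card_image_le[of "{..2 ^ m * Ny}"] by simp

lemma finite_grid: "finite (grid B Ny m)"
  unfolding grid_eq_image by simp

lemma grid_nonempty: "grid B Ny m \<noteq> {}"
  unfolding grid_eq_image by blast

text \<open>Only the coefficients up to \<open>q\<close> are read, so they can be taken extensional;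
  this exhibits the class as the image of a finite set and counts it.\<close>

lemma poly_class_eq_image:
  "poly_class B q Ny m c = taylor_poly B q c ` ({..q} \<rightarrow>\<^sub>E grid B Ny m)" (is "?L = ?R")
proof
  show "?L \<subseteq> ?R"
  proof
    fix P assume "P \<in> ?L"
    then obtain cs where cs: "P = taylor_poly B q c cs" "\<forall>i\<le>q. cs i \<in> grid B Ny m"
      by (auto simp: poly_class_def)
    have "P = taylor_poly B q c (restrict cs {..q})" unfolding cs taylor_poly_def by simp
    then show "P \<in> ?R" using cs(2) by auto
  qed
  show "?R \<subseteq> ?L" unfolding poly_class_def by (fastforce simp: PiE_iff)
qed

lemma finite_poly_class: "finite (poly_class B q Ny m c)"
  unfolding poly_class_eq_image by (intro finite_imageI finite_PiE) (auto simp: finite_grid)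

lemma poly_class_nonempty: "poly_class B q Ny m c \<noteq> {}"
  unfolding poly_class_eq_image by (simp add: PiE_eq_empty_iff grid_nonempty)

lemma card_poly_class_le: "card (poly_class B q Ny m c) \<le> (2 ^ m * Ny + 1) ^ (q + 1)"
proof -
  have "card (poly_class B q Ny m c) \<le> card ({..q} \<rightarrow>\<^sub>E grid B Ny m)"
    unfolding poly_class_eq_image by (intro card_image_le finite_PiE) (auto simp: finite_grid)
  also have "\<dots> = card (grid B Ny m) ^ (q + 1)" by (simp add: card_PiE)
  also have "\<dots> \<le> (2 ^ m * Ny + 1) ^ (q + 1)" by (intro power_mono card_grid_le) simp
  finally show ?thesis .
qed

lemma abs_poly_class_le: "P \<in> poly_class B q Ny m c \<Longrightarrow> 0 \<le> B \<Longrightarrow> \<bar>P x\<bar> \<le> B"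
  by (auto simp: poly_class_def taylor_poly_def abs_clip_le)

lemma parent_level1: "n \<in> {1..4 ^ 1} \<Longrightarrow> parent n = 1"
  by (auto simp: parent_def)

text \<open>With \<open>Pmn \<dots> 0 1\<close> in place of \<open>P0\<close> the case distinction at \<open>m = 1\<close> disappears.\<close>
lemma Qset_eq_image:
  assumes "1 \<le> a" "0 < Nx" "1 \<le> m" "n \<in> {1..4 ^ m}"
  shows "Qset B q gam Nx Ny a m n = (\<lambda>(P, P') z. clip (3 * gam / 2 ^ m) (P z - P' z)) `
     (Pmn B q Nx Ny a m n \<times> Pmn B q Nx Ny a (m - 1) (parent n))"
proof -
  have "(if m = 1 then P0 B q Nx Ny a else Pmn B q Nx Ny a (m - 1) (parent n))
      = Pmn B q Nx Ny a (m - 1) (parent n)"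
    using assms P0_eq_Pmn parent_level1[of n] by auto
  then show ?thesis unfolding Qset_def by auto
qed

lemma Qset_props:
  assumes "1 \<le> a" "0 < Nx" "1 \<le> m" "n \<in> {1..4 ^ m}"
  shows finite_Qset: "finite (Qset B q gam Nx Ny a m n)"
    and Qset_nonempty: "Qset B q gam Nx Ny a m n \<noteq> {}"
    and card_Qset_le: "card (Qset B q gam Nx Ny a m n) \<le> (2 ^ m * Ny + 1) ^ (2 * (q + 1))"
proof -
  show "finite (Qset B q gam Nx Ny a m n)"
    unfolding Qset_eq_image[OF assms] Pmn_def by (simp add: finite_poly_class)
  show "Qset B q gam Nx Ny a m n \<noteq> {}"
    unfolding Qset_eq_image[OF assms] Pmn_def by (simp add: poly_class_nonempty)
  have "card (Qset B q gam Nx Ny a m n)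
      \<le> card (Pmn B q Nx Ny a m n \<times> Pmn B q Nx Ny a (m - 1) (parent n))"
    unfolding Qset_eq_image[OF assms] Pmn_def by (intro card_image_le) (simp add: finite_poly_class)
  also have "\<dots> \<le> (2 ^ m * Ny + 1) ^ (q + 1) * (2 ^ (m - 1) * Ny + 1) ^ (q + 1)"
    unfolding card_cartesian_product Pmn_def by (intro mult_mono card_poly_class_le) auto
  also have "\<dots> \<le> (2 ^ m * Ny + 1) ^ (q + 1) * (2 ^ m * Ny + 1) ^ (q + 1)"
    by (intro mult_left_mono power_mono add_right_mono mult_right_mono power_increasing) auto
  also have "\<dots> = (2 ^ m * Ny + 1) ^ (2 * (q + 1))" by (simp only: power_add[symmetric] mult_2)
  finally show "card (Qset B q gam Nx Ny a m n) \<le> (2 ^ m * Ny + 1) ^ (2 * (q + 1))" .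
qed

lemma abs_Qset_le: "Q \<in> Qset B q gam Nx Ny a m n \<Longrightarrow> 0 \<le> gam \<Longrightarrow> \<bar>Q x\<bar> \<le> 3 * gam / 2 ^ m"
  by (auto simp: Qset_def intro!: abs_clip_le)

lemma blocks_eq_Sigma: "blocks M = (SIGMA m:{1..M}. {1..4 ^ m})"
  by (auto simp: blocks_def)

lemma sum_blocks: "(\<Sum>(m, n)\<in>blocks M. h m n) = (\<Sum>m=1..M. \<Sum>n=1..4 ^ m. h m n)"
  unfolding blocks_eq_Sigma by (subst sum.Sigma) auto

text \<open>Each block is a separate exponentiated gradient instance to which
  \<open>adaptive_EG_regret\<close> applies with \<open>b = 30 * B * gam / 2 ^ m\<close>.\<close>

lemma ameg_weights_eq_gibbs:
  "ameg_weights B q gam Nx Ny a G C (m, n) =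
    gibbs (1 / (30 * B * gam / 2 ^ m) * sqrt (ln (card (Qset B q gam Nx Ny a m n)) / (1 + real (C (m, n)))))
      (Qset B q gam Nx Ny a m n) (G (m, n))"
  unfolding ameg_weights_def gibbs_def Let_def by simp

section \<open>The chain of subcells containing a point\<close>

definition sub_index :: "nat \<Rightarrow> nat \<Rightarrow> real \<Rightarrow> nat \<Rightarrow> nat" where
  "sub_index Nx a x m = (SOME n. n \<in> {1..4 ^ m} \<and> in_sub Nx a m n x)"

lemma sub_index:
  assumes "0 < Nx" "1 \<le> a" "in_cell Nx a x"
  shows "sub_index Nx a x m \<in> {1..4 ^ m}" "in_sub Nx a m (sub_index Nx a x m) x"
  using someI_ex[of "\<lambda>n. n \<in> {1..4 ^ m} \<and> in_sub Nx a m n x"] in_sub_exists[OF assms, of m]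
  unfolding sub_index_def by blast+

lemma sub_index_eq:
  assumes "0 < Nx" "1 \<le> a" "in_cell Nx a x" "n \<in> {1..4 ^ m}" "in_sub Nx a m n x"
  shows "sub_index Nx a x m = n"
  using in_sub_unique[OF assms(1-3) sub_index(1)[OF assms(1-3)] assms(4) sub_index(2)[OF assms(1-3)] assms(5)] .

lemma parent_sub_index:
  assumes "0 < Nx" "1 \<le> a" "in_cell Nx a x"
  shows "parent (sub_index Nx a x (Suc m)) = sub_index Nx a x m"
  using sub_index_eq[OF assms parent_range[OF sub_index(1)[OF assms]]
      in_sub_parent[OF assms(1) sub_index[OF assms]]] ..

text \<open>Stated with an indicator factor, as in \<open>expert_fun\<close>, so that the
  \<open>4 ^ m\<close> blocks of a level collapse to the one that contains \<open>x\<close>.\<close>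

lemma sum_in_sub:
  fixes h :: "nat \<Rightarrow> real"
  assumes "0 < Nx" "1 \<le> a" "in_cell Nx a x"
  shows "(\<Sum>n=1..4 ^ m. h n * (if in_sub Nx a m n x then 1 else 0)) = h (sub_index Nx a x m)"
proof -
  have "(\<Sum>n=1..4 ^ m. h n * (if in_sub Nx a m n x then 1 else 0))
      = (\<Sum>n=1..4 ^ m. if n = sub_index Nx a x m then h n else 0)"
  proof (rule sum.cong[OF refl])
    fix n :: nat assume "n \<in> {1..4 ^ m}"
    then have "in_sub Nx a m n x \<longleftrightarrow> n = sub_index Nx a x m"
      using sub_index_eq[OF assms, of n m] sub_index(2)[OF assms, of m] by metis
    then show "h n * (if in_sub Nx a m n x then 1 else 0) = (if n = sub_index Nx a x m then h n else 0)"
      by simp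
  qed
  also have "\<dots> = h (sub_index Nx a x m)"
    using sub_index(1)[OF assms, of m] by simp
  finally show ?thesis .
qed

lemma expert_fun_eq:
  assumes "0 < Nx" "1 \<le> a" "in_cell Nx a x"
  shows "expert_fun B q gam Nx Ny M a P u x = P x +
    (\<Sum>m=1..M. \<Sum>Q\<in>Qset B q gam Nx Ny a m (sub_index Nx a x m). u (m, sub_index Nx a x m) Q * Q x)"
  unfolding expert_fun_def sum_blocks sum_distrib_right[symmetric] sum_in_sub[OF assms] by simp

lemma sum_half_powers_le: "(\<Sum>m=1..M. c / 2 ^ m) \<le> c" if "0 \<le> (c::real)"
proof -
  have "(\<Sum>m=1..M. c / 2 ^ m) = c - c / 2 ^ M"
    by (induction M) (auto simp: field_simps)
  then show ?thesis using that by simp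
qed

text \<open>Each level adds one average of functions bounded by \<open>3 * gam / 2 ^ m\<close>, and
  these bounds form a geometric series.\<close>

lemma abs_expert_fun_le:
  assumes "0 < Nx" "1 \<le> a" "in_cell Nx a x" "P \<in> P0 B q Nx Ny a" "0 \<le> B" "0 \<le> gam"
    and u: "in_simplices B q gam Nx Ny M a u"
  shows "\<bar>expert_fun B q gam Nx Ny M a P u x\<bar> \<le> B + 3 * gam"
proof -
  have "\<bar>\<Sum>Q\<in>Qset B q gam Nx Ny a m (sub_index Nx a x m). u (m, sub_index Nx a x m) Q * Q x\<bar> \<le> 3 * gam / 2 ^ m"
    if "m \<in> {1..M}" for m
  proof (rule abs_average_le)
    have k: "(m, sub_index Nx a x m) \<in> blocks M"
      using that sub_index(1)[OF assms(1-3), of m] by (auto simp: blocks_def)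
    show "(\<Sum>Q\<in>Qset B q gam Nx Ny a m (sub_index Nx a x m). u (m, sub_index Nx a x m) Q) = 1"
      using u k unfolding in_simplices_def by blast
    show "0 \<le> u (m, sub_index Nx a x m) Q" if "Q \<in> Qset B q gam Nx Ny a m (sub_index Nx a x m)" for Q
      using u k that unfolding in_simplices_def by blast
  qed (use abs_Qset_le assms in blast)
  then have "\<bar>\<Sum>m=1..M. \<Sum>Q\<in>Qset B q gam Nx Ny a m (sub_index Nx a x m). u (m, sub_index Nx a x m) Q * Q x\<bar>
      \<le> (\<Sum>m=1..M. 3 * gam / 2 ^ m)"
    by (intro order_trans[OF sum_abs sum_mono])
  also have "\<dots> \<le> 3 * gam" using assms by (intro sum_half_powers_le) auto
  finally show ?thesis
    using abs_poly_class_le[OF assms(4)[unfolded P0_def] assms(5), of x]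
    unfolding expert_fun_eq[OF assms(1-3)] by linarith
qed

lemma ameg_weights_in_simplices:
  assumes "1 \<le> a" "0 < Nx"
  shows "in_simplices B q gam Nx Ny M a (ameg_weights B q gam Nx Ny a G C)"
  unfolding in_simplices_def
proof (safe)
  fix m n assume k: "(m, n) \<in> blocks M"
  then have mn: "1 \<le> m" "n \<in> {1..4 ^ m}" by (auto simp: blocks_def)
  show "0 \<le> ameg_weights B q gam Nx Ny a G C (m, n) Q" for Q
    unfolding ameg_weights_eq_gibbs by (rule gibbs_nonneg)
  show "(\<Sum>Q\<in>Qset B q gam Nx Ny a m n. ameg_weights B q gam Nx Ny a G C (m, n) Q) = 1"
    unfolding ameg_weights_eq_gibbs using Qset_props[OF assms mn] by (intro sum_gibbs)
qed

section \<open>Regret of the nested chaining algorithm\<close>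

locale nested_chaining =
  fixes B gam :: real and q Nx Ny M T :: nat and xs ys :: "nat \<Rightarrow> real"
  assumes B: "0 < B" and gam: "0 < gam" "gam \<le> B" and Nx: "0 < Nx" and Ny: "0 < Ny"
    and xs: "\<And>t. xs t \<in> {0..1}" and ys: "\<And>t. t \<in> {1..T} \<Longrightarrow> \<bar>ys t\<bar> \<le> B"
begin

text \<open>Index \<open>t\<close> refers to the state after \<open>t\<close> rounds. That state
  determines the weights and experts used in round \<open>Suc t\<close>, hence the shifted data
  \<open>xs (Suc t)\<close> and \<open>ys (Suc t)\<close>.\<close>

definition "grads t a P k Q = fst (nca_state B q gam Nx Ny M xs ys t) a P k Q"
definition "counts t a P k = fst (snd (nca_state B q gam Nx Ny M xs ys t)) a P k"
definition "losses t a P = snd (snd (nca_state B q gam Nx Ny M xs ys t)) a P"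
definition "weights t a P = ameg_weights B q gam Nx Ny a (grads t a P) (counts t a P)"
definition "expert t a P = expert_fun B q gam Nx Ny M a P (weights t a P)"
text \<open>Zero outside the cell, so the recursion for \<open>grads\<close> has no side condition
  and sums can run over all rounds.\<close>

definition "grad t a P k Q =
  (if in_cell Nx a (xs (Suc t)) \<and> k \<in> blocks M
   then loss_grad B q gam Nx Ny M a P (weights t a P) (xs (Suc t)) (ys (Suc t)) (fst k) (snd k) Q else 0)"
definition "active t a P k \<longleftrightarrow> in_cell Nx a (xs (Suc t)) \<and> k \<in> blocks M \<and>
  grad_active B q gam Nx Ny M a P (xs (Suc t)) (ys (Suc t)) (fst k) (snd k)"

abbreviation "classQ a m n \<equiv> Qset B q gam Nx Ny a m n"

lemma state_0: "grads 0 a P k = (\<lambda>_. 0)" "counts 0 a P k = 0" "losses 0 a = (\<lambda>_. 0)"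
  by (auto simp: grads_def counts_def losses_def)

lemma grads_Suc: "grads (Suc t) a P k Q = grads t a P k Q + grad t a P k Q"
  by (simp add: grads_def grad_def weights_def counts_def[abs_def] grads_def[abs_def] Let_def split: prod.split)

lemma counts_Suc: "counts (Suc t) a P k = counts t a P k + (if active t a P k then 1 else 0)"
  by (simp add: active_def counts_def Let_def split: prod.split)

lemma losses_Suc: "losses (Suc t) a P = losses t a P +
    (if in_cell Nx a (xs (Suc t)) then (ys (Suc t) - expert t a P (xs (Suc t)))\<^sup>2 else 0)"
  by (simp add: losses_def expert_def weights_def counts_def[abs_def] grads_def[abs_def] Let_def split: prod.split)

lemma predict_eq:
  assumes "a \<in> {1..Nx}" "in_cell Nx a (xs (Suc t))"
  shows "nca_predict B q gam Nx Ny M xs ys (Suc t) =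
    (\<Sum>P\<in>P0 B q Nx Ny a. gibbs (1 / (50 * B\<^sup>2)) (P0 B q Nx Ny a) (losses t a) P * expert t a P (xs (Suc t)))"
    (is "_ = ?R")
proof -
  let ?h = "\<lambda>a'. \<Sum>P\<in>P0 B q Nx Ny a'. gibbs (1 / (50 * B\<^sup>2)) (P0 B q Nx Ny a') (losses t a') P *
    expert t a' P (xs (Suc t))"
  have "nca_predict B q gam Nx Ny M xs ys (Suc t) = (\<Sum>a'\<in>{1..Nx}. if in_cell Nx a' (xs (Suc t)) then ?h a' else 0)"
    unfolding nca_predict_def
    by (simp add: gibbs_def losses_def[abs_def] expert_def weights_def counts_def[abs_def] grads_def[abs_def]
        case_prod_beta cong: if_cong)
  also have "\<dots> = (\<Sum>a'\<in>{1..Nx}. if a' = a then ?h a' else 0)"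
  proof (rule sum.cong[OF refl])
    fix a' assume "a' \<in> {1..Nx}"
    then have "in_cell Nx a' (xs (Suc t)) \<longleftrightarrow> a' = a"
      using in_cell_unique[OF Nx _ _ assms(1) _ assms(2), of a'] assms xs[of "Suc t"] by auto
    then show "(if in_cell Nx a' (xs (Suc t)) then ?h a' else 0) = (if a' = a then ?h a' else 0)"
      by (simp only:)
  qed
  also have "\<dots> = ?R" using assms by simp
  finally show ?thesis .
qed

text \<open>\<open>B\<close> for the outcome and \<open>B + 3 * gam\<close> for the prediction, with
  \<open>gam \<le> B\<close>.\<close>

lemma abs_residual_le:
  assumes "1 \<le> a" "in_cell Nx a (xs (Suc t))" "t < T" "P \<in> P0 B q Nx Ny a"
  shows "\<bar>ys (Suc t) - expert t a P (xs (Suc t))\<bar> \<le> 5 * B"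
proof -
  have "\<bar>expert t a P (xs (Suc t))\<bar> \<le> B + 3 * gam"
    unfolding expert_def weights_def using assms B gam Nx
    by (intro abs_expert_fun_le ameg_weights_in_simplices) auto
  then show ?thesis using ys[of "Suc t"] assms gam by auto
qed

section \<open>Regret inside one cell\<close>

lemma block_regret:
  assumes a: "1 \<le> a" and P: "P \<in> P0 B q Nx Ny a" and m: "m \<in> {1..M}" and n: "n \<in> {1..4 ^ m}"
    and Q: "Q \<in> classQ a m n"
  shows "(\<Sum>t<T. \<Sum>Q'\<in>classQ a m n. weights t a P (m, n) Q' * grad t a P (m, n) Q') - grads T a P (m, n) Q
    \<le> 6 * (30 * B * gam / 2 ^ m) * sqrt (ln (card (classQ a m n))) * sqrt (counts T a P (m, n))"
proof -
  have m1: "1 \<le> m" using m by simp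
  have k: "(m, n) \<in> blocks M" using m n by (auto simp: blocks_def)
  have weights: "weights t a P (m, n) = gibbs (1 / (30 * B * gam / 2 ^ m) *
      sqrt (ln (card (classQ a m n)) / (1 + real (counts t a P (m, n))))) (classQ a m n) (grads t a P (m, n))" for t
    unfolding weights_def ameg_weights_eq_gibbs ..
  show ?thesis
    unfolding weights
  proof (rule adaptive_EG_regret[where act = "\<lambda>t. active t a P (m, n)"])
    show "finite (classQ a m n)" by (rule finite_Qset[OF a Nx m1 n])
    show "grad t a P (m, n) Q' = 0" if "Q' \<in> classQ a m n" "\<not> active t a P (m, n)" for t Q'
    proof (rule ccontr)
      assume "grad t a P (m, n) Q' \<noteq> 0"
      then have "in_cell Nx a (xs (Suc t))"
        and g: "loss_grad B q gam Nx Ny M a P (weights t a P) (xs (Suc t)) (ys (Suc t)) m n Q' \<noteq> 0"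
        by (auto simp: grad_def split: if_splits)
      \<comment> \<open>The weights actually played lie in the simplices, so a nonzero realised
        gradient witnesses that the round is active.\<close>
      moreover have "in_simplices B q gam Nx Ny M a (weights t a P)"
        unfolding weights_def by (rule ameg_weights_in_simplices[OF a Nx])
      ultimately show False using that k unfolding active_def grad_active_def by auto
    qed
    show "\<bar>grad t a P (m, n) Q'\<bar> \<le> 30 * B * gam / 2 ^ m" if "t < T" "Q' \<in> classQ a m n" for t Q'
    proof (cases "in_cell Nx a (xs (Suc t)) \<and> in_sub Nx a m n (xs (Suc t))")
      case True
      have "grad t a P (m, n) Q' = - 2 * ((ys (Suc t) - expert t a P (xs (Suc t))) * Q' (xs (Suc t)))"
        using True k by (simp add: grad_def loss_grad_def expert_def algebra_simps)
      then have "\<bar>grad t a P (m, n) Q'\<bar> = 2 * (\<bar>ys (Suc t) - expert t a P (xs (Suc t))\<bar> * \<bar>Q' (xs (Suc t))\<bar>)"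
        by (simp add: abs_mult)
      \<comment> \<open>The 30 of the gradient bound is \<open>2 * 5 * 3\<close>: derivative of the
        square, residual, and clipping level.\<close>
      also have "\<dots> \<le> 2 * ((5 * B) * (3 * gam / 2 ^ m))"
        using B gam that True a P
        by (intro mult_left_mono mult_mono abs_residual_le abs_Qset_le) auto
      finally show ?thesis by simp
    next
      case False
      then have "grad t a P (m, n) Q' = 0" by (auto simp: grad_def loss_grad_def)
      then show ?thesis using B gam by simp
    qed
  qed (use Q B gam in \<open>auto simp: state_0 grads_Suc counts_Suc\<close>)
qed

lemma grads_eq: "grads t a P k Q = (\<Sum>s<t. grad s a P k Q)"
  by (induction t) (auto simp: state_0 grads_Suc)

lemma losses_eq: "losses t a P = (\<Sum>s<t. if in_cell Nx a (xs (Suc s))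
    then (ys (Suc s) - expert s a P (xs (Suc s)))\<^sup>2 else 0)"
  by (induction t) (auto simp: state_0 losses_Suc)

definition "cell_count a = (\<Sum>t<T. if in_cell Nx a (xs (Suc t)) then 1 else (0::real))"

text \<open>A nonzero gradient requires the point to lie in the subcell of the block, and each visit
  to the cell falls into exactly one subcell of level \<open>m\<close>. The counts of a level
  therefore sum to at most \<open>cell_count a\<close>, and Cauchy--Schwarz contributes
  \<open>sqrt (4 ^ m)\<close>.\<close>

lemma sum_sqrt_counts_le:
  assumes a: "1 \<le> a" and m: "m \<in> {1..M}"
  shows "(\<Sum>n=1..4 ^ m. sqrt (counts T a P (m, n))) \<le> 2 ^ m * sqrt (cell_count a)"
proof -
  have "real (counts t a P (m, n))
      \<le> (\<Sum>s<t. if in_cell Nx a (xs (Suc s)) then 1 * (if in_sub Nx a m n (xs (Suc s)) then 1 else 0) else 0)" for t n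
  proof (induction t)
    case (Suc t)
    have "in_cell Nx a (xs (Suc t)) \<and> in_sub Nx a m n (xs (Suc t))" if "active t a P (m, n)"
      using that by (auto simp: active_def grad_active_def loss_grad_def split: if_splits)
    then show ?case using Suc by (auto simp: counts_Suc)
  qed (simp add: state_0)
  then have "(\<Sum>n=1..4 ^ m. real (counts T a P (m, n)))
      \<le> (\<Sum>n=1..4 ^ m. \<Sum>s<T. if in_cell Nx a (xs (Suc s)) then 1 * (if in_sub Nx a m n (xs (Suc s)) then 1 else 0) else 0)"
    by (intro sum_mono)
  also have "\<dots> = (\<Sum>s<T. \<Sum>n=1..4 ^ m. if in_cell Nx a (xs (Suc s)) then 1 * (if in_sub Nx a m n (xs (Suc s)) then 1 else 0) else 0)"
    by (rule sum.swap)
  also have "\<dots> = cell_count a"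
    unfolding cell_count_def
  proof (rule sum.cong)
    fix s
    show "(\<Sum>n=1..4 ^ m. if in_cell Nx a (xs (Suc s)) then 1 * (if in_sub Nx a m n (xs (Suc s)) then 1 else 0) else 0)
        = (if in_cell Nx a (xs (Suc s)) then 1 else (0::real))"
      using sum_in_sub[OF Nx a, of "xs (Suc s)" "\<lambda>_. 1" m]
      by (cases "in_cell Nx a (xs (Suc s))") auto
  qed simp
  finally have le: "(\<Sum>n=1..4 ^ m. real (counts T a P (m, n))) \<le> cell_count a" .
  have "(\<Sum>n=1..4 ^ m. sqrt (counts T a P (m, n)))\<^sup>2
      \<le> (\<Sum>n=1..4 ^ m. (sqrt (counts T a P (m, n)))\<^sup>2) * card {1..4 ^ m :: nat}"
    by (rule sum_squared_le_sum_of_squares)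
  also have "\<dots> = (\<Sum>n=1..4 ^ m. real (counts T a P (m, n))) * 4 ^ m" by simp
  also have "\<dots> \<le> cell_count a * 4 ^ m" using le by (intro mult_right_mono) auto
  finally have "(\<Sum>n=1..4 ^ m. sqrt (counts T a P (m, n))) \<le> sqrt (cell_count a * 4 ^ m)"
    by (rule real_le_rsqrt)
  also have "sqrt (4 ^ m) = (2::real) ^ m"
    by (rule real_sqrt_unique) (auto simp: power2_eq_square power_mult_distrib[symmetric])
  then have "sqrt (cell_count a * 4 ^ m) = 2 ^ m * sqrt (cell_count a)"
    by (simp add: real_sqrt_mult)
  finally show ?thesis .
qed

text \<open>The loss of an instance is convex in its weights, so its regret is at most the linearised one,
  which splits over the blocks; Cauchy--Schwarz over the \<open>4 ^ m\<close> blocks of level \<open>m\<close> costs a factor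
  \<open>2 ^ m\<close> that is compensated by the gradient bound.\<close>
lemma instance_regret:
  assumes a: "1 \<le> a" and P: "P \<in> P0 B q Nx Ny a"
    and Qs: "\<And>m n. m \<in> {1..M} \<Longrightarrow> n \<in> {1..4 ^ m} \<Longrightarrow> Qs m n \<in> classQ a m n"
    and S: "\<And>m n. m \<in> {1..M} \<Longrightarrow> n \<in> {1..4 ^ m} \<Longrightarrow> sqrt (ln (card (classQ a m n))) \<le> S" "0 \<le> S"
  shows "losses T a P \<le> (\<Sum>t<T. if in_cell Nx a (xs (Suc t))
      then (ys (Suc t) - (P (xs (Suc t)) + (\<Sum>m=1..M. Qs m (sub_index Nx a (xs (Suc t)) m) (xs (Suc t)))))\<^sup>2 else 0)
    + 180 * B * gam * M * S * sqrt (cell_count a)"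
proof -
  define cmp where "cmp t = P (xs (Suc t)) + (\<Sum>m=1..M. Qs m (sub_index Nx a (xs (Suc t)) m) (xs (Suc t)))" for t
  define lin where "lin t m n = (\<Sum>Q\<in>classQ a m n. weights t a P (m, n) Q * grad t a P (m, n) Q)
      - grad t a P (m, n) (Qs m n)" for t m n
  have step: "(if in_cell Nx a (xs (Suc t)) then (ys (Suc t) - expert t a P (xs (Suc t)))\<^sup>2 else 0)
      - (if in_cell Nx a (xs (Suc t)) then (ys (Suc t) - cmp t)\<^sup>2 else 0)
      \<le> (\<Sum>m=1..M. \<Sum>n=1..4 ^ m. lin t m n)" for t
  proof (cases "in_cell Nx a (xs (Suc t))")
    case False
    then show ?thesis by (simp add: lin_def grad_def)
  next
    case True
    define x y e where "x = xs (Suc t)" and "y = ys (Suc t)" and "e = expert t a P (xs (Suc t))"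
    have lin: "lin t m n = (- 2 * (y - e) * ((\<Sum>Q\<in>classQ a m n. weights t a P (m, n) Q * Q x) - Qs m n x))
        * (if in_sub Nx a m n x then 1 else 0)" if "m \<in> {1..M}" "n \<in> {1..4 ^ m}" for m n
    proof -
      have "grad t a P (m, n) Q = - 2 * (y - e) * (Q x * (if in_sub Nx a m n x then 1 else 0))" for Q
        using True that by (simp add: grad_def loss_grad_def x_def y_def e_def expert_def blocks_def)
      moreover have "(\<Sum>Q\<in>classQ a m n. weights t a P (m, n) Q * (c * (Q x * i)))
          = c * (\<Sum>Q\<in>classQ a m n. weights t a P (m, n) Q * Q x) * i" for c i
        by (simp add: sum_distrib_left sum_distrib_right mult_ac)
      ultimately show ?thesis unfolding lin_def by (simp only:) (simp only: algebra_simps)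
    qed
    have "(\<Sum>m=1..M. \<Sum>n=1..4 ^ m. lin t m n) = (\<Sum>m=1..M. \<Sum>n=1..4 ^ m.
        (- 2 * (y - e) * ((\<Sum>Q\<in>classQ a m n. weights t a P (m, n) Q * Q x) - Qs m n x))
        * (if in_sub Nx a m n x then 1 else 0))"
      by (intro sum.cong refl lin)
    also have "\<dots> = - 2 * (y - e) * (e - cmp t)"
      unfolding sum_in_sub[OF Nx a True, folded x_def]
      unfolding sum_distrib_left[symmetric] sum_subtractf e_def expert_def expert_fun_eq[OF Nx a True] cmp_def x_def
      by simp
    \<comment> \<open>Convexity of the square loss; what is dropped is exactly
      \<open>(e - cmp t)\<^sup>2\<close>.\<close>
    also have "\<dots> \<ge> (y - e)\<^sup>2 - (y - cmp t)\<^sup>2"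
      using zero_le_power2[of "e - cmp t"] by (simp add: power2_eq_square algebra_simps)
    finally show ?thesis using True by (simp add: y_def e_def)
  qed
  have "losses T a P - (\<Sum>t<T. if in_cell Nx a (xs (Suc t)) then (ys (Suc t) - cmp t)\<^sup>2 else 0)
      \<le> (\<Sum>t<T. \<Sum>m=1..M. \<Sum>n=1..4 ^ m. lin t m n)"
    unfolding losses_eq sum_subtractf[symmetric] by (intro sum_mono step)
  also have "\<dots> = (\<Sum>m=1..M. \<Sum>t<T. \<Sum>n=1..4 ^ m. lin t m n)" by (rule sum.swap)
  also have "\<dots> = (\<Sum>m=1..M. \<Sum>n=1..4 ^ m. \<Sum>t<T. lin t m n)"
    by (rule sum.cong[OF refl]) (rule sum.swap)
  also have "\<dots> \<le> (\<Sum>m=1..M. \<Sum>n=1..4 ^ m. 6 * (30 * B * gam / 2 ^ m) * S * sqrt (counts T a P (m, n)))"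
  proof (intro sum_mono)
    fix m n assume mn: "m \<in> {1..M}" "n \<in> {1..4 ^ m :: nat}"
    have "(\<Sum>t<T. lin t m n) \<le> 6 * (30 * B * gam / 2 ^ m) * sqrt (ln (card (classQ a m n))) * sqrt (counts T a P (m, n))"
      using block_regret[OF a P mn Qs[OF mn]] unfolding lin_def sum_subtractf grads_eq .
    also have "\<dots> \<le> 6 * (30 * B * gam / 2 ^ m) * S * sqrt (counts T a P (m, n))"
      using B gam by (intro mult_right_mono mult_left_mono S(1)[OF mn]) auto
    finally show "(\<Sum>t<T. lin t m n) \<le> 6 * (30 * B * gam / 2 ^ m) * S * sqrt (counts T a P (m, n))" .
  qed
  also have "\<dots> = (\<Sum>m=1..M. 6 * (30 * B * gam / 2 ^ m) * S * (\<Sum>n=1..4 ^ m. sqrt (counts T a P (m, n))))"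
    by (simp only: sum_distrib_left)
  also have "\<dots> \<le> (\<Sum>m=1..M. 6 * (30 * B * gam / 2 ^ m) * S * (2 ^ m * sqrt (cell_count a)))"
    using B gam S(2) by (intro sum_mono mult_left_mono sum_sqrt_counts_le a) auto
  also have "\<dots> = 180 * B * gam * M * S * sqrt (cell_count a)" by simp
  finally show ?thesis unfolding cmp_def by simp
qed

end

lemma square_loss_diff_le:
  fixes y p v \<epsilon> b :: real
  assumes "\<bar>y\<bar> \<le> b" "\<bar>p\<bar> \<le> b" "\<bar>v\<bar> \<le> b" "\<bar>p - v\<bar> \<le> \<epsilon>"
  shows "(y - p)\<^sup>2 \<le> (y - v)\<^sup>2 + 4 * b * \<epsilon>"
proof -
  have "(y - p)\<^sup>2 - (y - v)\<^sup>2 = (p - v) * (p + v - 2 * y)" by (simp add: power2_eq_square algebra_simps)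
  also have "\<dots> \<le> \<bar>p - v\<bar> * \<bar>p + v - 2 * y\<bar>" by (metis abs_ge_self abs_mult)
  also have "\<dots> \<le> \<epsilon> * (4 * b)" using assms by (intro mult_mono) auto
  finally show ?thesis by (simp add: algebra_simps)
qed

lemma ln_of_nat_le_power:
  assumes "0 < c" "c \<le> N ^ k"
  shows "ln (real c) \<le> real k * ln (real N)"
proof (cases "k = 0")
  case False
  then have N: "0 < N" using assms by (cases N) (auto simp: power_0_left)
  have "real c \<le> real N ^ k" using assms(2) by (metis of_nat_le_iff of_nat_power)
  then have "ln (real c) \<le> ln (real N ^ k)" using assms(1) N by (subst ln_le_cancel_iff) auto
  then show ?thesis using N by (simp add: ln_realpow)
qed (use assms in simp)

context nested_chaining
begin

text \<open>Consecutive approximations differ by at most \<open>gam / 2 ^ m + gam / 2 ^ (m - 1)\<close>, so the clipping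
  in the classes of differences is inactive and the sum telescopes.\<close>
lemma telescoping_comparator:
  assumes a: "1 \<le> a" and cell: "in_cell Nx a x" and x: "x \<in> {0..1}"
    and close: "\<And>m n. n \<in> {1..4 ^ m} \<Longrightarrow> in_sub Nx a m n x \<Longrightarrow> \<bar>Pf m n x - f x\<bar> \<le> gam / 2 ^ m"
  shows "Pf 0 1 x + (\<Sum>m=1..k. clip (3 * gam / 2 ^ m)
      (Pf m (sub_index Nx a x m) x - Pf (m - 1) (parent (sub_index Nx a x m)) x)) = Pf k (sub_index Nx a x k) x"
proof (induction k)
  case 0
  then show ?case using sub_index(1)[OF Nx a cell, of 0] by simp
next
  case (Suc k)
  note i = sub_index[OF Nx a cell]
  have "\<bar>Pf (Suc k) (sub_index Nx a x (Suc k)) x - f x\<bar> \<le> gam / 2 ^ Suc k"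
    "\<bar>Pf k (sub_index Nx a x k) x - f x\<bar> \<le> gam / 2 ^ k"
    using close i by blast+
  moreover have "gam / 2 ^ Suc k + gam / 2 ^ k = 3 * gam / 2 ^ Suc k" by (simp add: field_simps)
  ultimately have "\<bar>Pf (Suc k) (sub_index Nx a x (Suc k)) x - Pf k (sub_index Nx a x k) x\<bar> \<le> 3 * gam / 2 ^ Suc k"
    by linarith
  then show ?case using Suc by (simp add: clip_eq parent_sub_index[OF Nx a cell])
qed

text \<open>Three costs add up: aggregation against the base polynomial \<open>Pf 0 1\<close>,
  exponentiated gradient against the differences of consecutive approximants, and the last error
  \<open>gam / 2 ^ M\<close>, which the square loss multiplies by at most \<open>4 * B\<close> per
  visit.\<close>

lemma cell_regret:
  assumes a: "a \<in> {1..Nx}" and f_le: "\<And>x. x \<in> {0..1} \<Longrightarrow> \<bar>f x\<bar> \<le> B"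
    and Pf: "\<And>m n. n \<in> {1..4 ^ m} \<Longrightarrow> Pf m n \<in> Pmn B q Nx Ny a m n"
    and close: "\<And>m n x. n \<in> {1..4 ^ m} \<Longrightarrow> x \<in> {0..1} \<Longrightarrow> in_sub Nx a m n x \<Longrightarrow> \<bar>Pf m n x - f x\<bar> \<le> gam / 2 ^ m"
    and S: "\<And>m n. m \<in> {1..M} \<Longrightarrow> n \<in> {1..4 ^ m} \<Longrightarrow> sqrt (ln (card (classQ a m n))) \<le> S" "0 \<le> S"
  shows "(\<Sum>t<T. if in_cell Nx a (xs (Suc t)) then (ys (Suc t) - nca_predict B q gam Nx Ny M xs ys (Suc t))\<^sup>2 else 0)
    \<le> (\<Sum>t<T. if in_cell Nx a (xs (Suc t)) then (ys (Suc t) - f (xs (Suc t)))\<^sup>2 else 0)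
      + 4 * B * (gam / 2 ^ M) * cell_count a
      + 180 * B * gam * M * S * sqrt (cell_count a) + 50 * B\<^sup>2 * ln (card (P0 B q Nx Ny a))"
proof -
  have a1: "1 \<le> a" using a by simp
  have P: "Pf 0 1 \<in> P0 B q Nx Ny a" unfolding P0_eq_Pmn[OF a1 Nx] by (rule Pf) simp
  define Qs where "Qs m n = (\<lambda>z. clip (3 * gam / 2 ^ m) (Pf m n z - Pf (m - 1) (parent n) z))" for m n
  have Qs: "Qs m n \<in> classQ a m n" if "m \<in> {1..M}" "n \<in> {1..4 ^ m}" for m n
  proof -
    have m: "1 \<le> m" "Suc (m - 1) = m" using that by auto
    have "Pf (m - 1) (parent n) \<in> Pmn B q Nx Ny a (m - 1) (parent n)"
      using that m(2) by (intro Pf parent_range) simp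
    then show ?thesis
      using Pf[OF that(2)] unfolding Qset_eq_image[OF a1 Nx m(1) that(2)] Qs_def by force
  qed
  define cmp where "cmp t = Pf 0 1 (xs (Suc t)) + (\<Sum>m=1..M. Qs m (sub_index Nx a (xs (Suc t)) m) (xs (Suc t)))" for t
  have "(\<Sum>t<T. if in_cell Nx a (xs (Suc t)) then (ys (Suc t) - nca_predict B q gam Nx Ny M xs ys (Suc t))\<^sup>2 else 0)
    = (\<Sum>t<T. if in_cell Nx a (xs (Suc t)) then (ys (Suc t) - (\<Sum>P\<in>P0 B q Nx Ny a.
        gibbs (1 / (50 * B\<^sup>2)) (P0 B q Nx Ny a) (losses t a) P * expert t a P (xs (Suc t))))\<^sup>2 else 0)"
    by (intro sum.cong refl if_cong) (simp only: predict_eq[OF a])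
  also have "\<dots> \<le> losses T a (Pf 0 1) + ln (card (P0 B q Nx Ny a)) / (1 / (50 * B\<^sup>2))"
  proof (rule exp_weights_regret[where r = "5 * B"])
    show "finite (P0 B q Nx Ny a)" unfolding P0_def by (rule finite_poly_class)
    \<comment> \<open>Equality holds: \<open>1 / (50 * B\<^sup>2)\<close> is the largest rate for
      which \<open>exp_square_concave\<close> covers residuals up to \<open>5 * B\<close>.\<close>
    show "2 * (1 / (50 * B\<^sup>2)) * (5 * B)\<^sup>2 \<le> 1" using B by (simp add: power2_eq_square)
  qed (use P B a1 abs_residual_le in \<open>auto simp: state_0 losses_Suc\<close>)
  also have "losses T a (Pf 0 1) \<le> (\<Sum>t<T. if in_cell Nx a (xs (Suc t)) then (ys (Suc t) - cmp t)\<^sup>2 else 0)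
      + 180 * B * gam * M * S * sqrt (cell_count a)"
    unfolding cmp_def by (rule instance_regret[OF a1 P Qs S])
  also have "(\<Sum>t<T. if in_cell Nx a (xs (Suc t)) then (ys (Suc t) - cmp t)\<^sup>2 else 0)
    \<le> (\<Sum>t<T. (if in_cell Nx a (xs (Suc t)) then (ys (Suc t) - f (xs (Suc t)))\<^sup>2 else 0)
        + 4 * B * (gam / 2 ^ M) * (if in_cell Nx a (xs (Suc t)) then 1 else 0))"
  proof (rule sum_mono)
    fix t assume t: "t \<in> {..<T}"
    define x where "x = xs (Suc t)"
    have x: "x \<in> {0..1}" using xs by (simp add: x_def)
    show "(if in_cell Nx a (xs (Suc t)) then (ys (Suc t) - cmp t)\<^sup>2 else 0)
      \<le> (if in_cell Nx a (xs (Suc t)) then (ys (Suc t) - f (xs (Suc t)))\<^sup>2 else 0)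
        + 4 * B * (gam / 2 ^ M) * (if in_cell Nx a (xs (Suc t)) then 1 else 0)"
    proof (cases "in_cell Nx a x")
      case True
      note i = sub_index[OF Nx a1 True, of M]
      have "cmp t = Pf M (sub_index Nx a x M) x"
        unfolding cmp_def Qs_def x_def[symmetric]
        by (rule telescoping_comparator[OF a1 True x, of Pf f]) (use close x in blast)
      moreover have "\<bar>Pf M (sub_index Nx a x M) x\<bar> \<le> B"
        using Pf[OF i(1)] B unfolding Pmn_def by (intro abs_poly_class_le) auto
      moreover have "\<bar>Pf M (sub_index Nx a x M) x - f x\<bar> \<le> gam / 2 ^ M" by (rule close[OF i(1) x i(2)])
      ultimately have "(ys (Suc t) - cmp t)\<^sup>2 \<le> (ys (Suc t) - f x)\<^sup>2 + 4 * B * (gam / 2 ^ M)"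
        using ys[of "Suc t"] t f_le[OF x] by (intro square_loss_diff_le) auto
      then show ?thesis using True by (simp add: x_def)
    qed (simp add: x_def)
  qed
  also have "\<dots> = (\<Sum>t<T. if in_cell Nx a (xs (Suc t)) then (ys (Suc t) - f (xs (Suc t)))\<^sup>2 else 0)
      + 4 * B * (gam / 2 ^ M) * cell_count a"
    unfolding cell_count_def sum.distrib sum_distrib_left ..
  finally show ?thesis by (simp add: mult_ac)
qed

section \<open>Summation over the cells\<close>

lemma sum_over_cells:
  fixes g :: "nat \<Rightarrow> real"
  shows "(\<Sum>a=1..Nx. \<Sum>t<T. if in_cell Nx a (xs (Suc t)) then g t else 0) = (\<Sum>t<T. g t)"
proof -
  have "(\<Sum>a=1..Nx. if in_cell Nx a (xs (Suc t)) then g t else 0) = g t" for t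
  proof -
    obtain a where a: "a \<in> {1..Nx}" "in_cell Nx a (xs (Suc t))"
      using in_cell_exists[OF Nx xs] by blast
    have "(\<Sum>a'=1..Nx. if in_cell Nx a' (xs (Suc t)) then g t else 0) = (\<Sum>a'=1..Nx. if a' = a then g t else 0)"
    proof (rule sum.cong[OF refl])
      fix a' assume "a' \<in> {1..Nx}"
      then have "in_cell Nx a' (xs (Suc t)) \<longleftrightarrow> a' = a"
        using in_cell_unique[OF Nx _ _ a(1) _ a(2), of a'] a xs[of "Suc t"] by auto
      then show "(if in_cell Nx a' (xs (Suc t)) then g t else 0) = (if a' = a then g t else 0)"
        by (simp only:)
    qed
    then show ?thesis using a by simp
  qed
  then show ?thesis by (subst sum.swap) simp
qed

lemma total_regret:
  assumes f: "f \<in> holder_class q B lam \<alpha>"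
    and lam: "0 < lam" and \<alpha>: "0 < \<alpha>" "real q + \<alpha> \<ge> 1/2"
    and hx: "lam / fact q * (1 / (2 * real Nx)) powr (real q + \<alpha>) \<le> gam / 2"
    and hy: "2 * B / real Ny \<le> gam / exp 1"
  shows "(\<Sum>t=1..T. (ys t - nca_predict B q gam Nx Ny M xs ys t)\<^sup>2) - (\<Sum>t=1..T. (ys t - f (xs t))\<^sup>2)
    \<le> 4 * B * (gam / 2 ^ M) * T
      + 180 * B * gam * M * sqrt (2 * (real q + 1) * ln (2 ^ M * real Ny + 1)) * sqrt (real Nx * T)
      + Nx * (50 * B\<^sup>2 * ((real q + 1) * ln (real Ny + 1)))"
proof -
  define S where "S = sqrt (2 * (real q + 1) * ln (2 ^ M * real Ny + 1))"
  define L0 where "L0 = (real q + 1) * ln (real Ny + 1)"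
  have f_le: "\<bar>f x\<bar> \<le> B" if "x \<in> {0..1}" for x
  proof -
    from f obtain D where "\<forall>x\<in>{0..1}. D 0 x = f x" "\<forall>k\<le>q. \<forall>x\<in>{0..1}. \<bar>D k x\<bar> \<le> B"
      unfolding holder_class_def mem_Collect_eq by (elim exE conjE) (rule that)
    then show ?thesis using that by (metis le0)
  qed
  have S0: "0 \<le> S" unfolding S_def by simp
  have S: "sqrt (ln (card (classQ a m n))) \<le> S" if a: "a \<in> {1..Nx}" and m: "m \<in> {1..M}" and n: "n \<in> {1..4 ^ m}" for a m n
  proof -
    have a1: "1 \<le> a" and m1: "1 \<le> m" using a m by auto
    have c: "card (classQ a m n) > 0" using Qset_props[OF a1 Nx m1 n] by (simp add: card_gt_0_iff)
    have "card (classQ a m n) \<le> (2 ^ m * Ny + 1) ^ (2 * (q + 1))" by (rule card_Qset_le[OF a1 Nx m1 n])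
    also have "\<dots> \<le> (2 ^ M * Ny + 1) ^ (2 * (q + 1))"
      using m by (intro power_mono add_right_mono mult_right_mono power_increasing) auto
    finally have "ln (card (classQ a m n)) \<le> real (2 * (q + 1)) * ln (real (2 ^ M * Ny + 1))"
      by (rule ln_of_nat_le_power[OF c])
    then have "ln (card (classQ a m n)) \<le> 2 * (real q + 1) * ln (2 ^ M * real Ny + 1)"
      by (simp add: add.commute)
    then show ?thesis unfolding S_def by simp
  qed
  have L0: "ln (card (P0 B q Nx Ny a)) \<le> L0" for a
  proof -
    have c: "card (P0 B q Nx Ny a) > 0"
      unfolding P0_def using poly_class_nonempty finite_poly_class by (simp add: card_gt_0_iff)
    have "ln (card (P0 B q Nx Ny a)) \<le> real (q + 1) * ln (real (2 ^ 0 * Ny + 1))"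
      using c unfolding P0_def by (intro ln_of_nat_le_power card_poly_class_le)
    then show ?thesis by (simp add: L0_def add.commute)
  qed
  have cell: "(\<Sum>t<T. if in_cell Nx a (xs (Suc t)) then (ys (Suc t) - nca_predict B q gam Nx Ny M xs ys (Suc t))\<^sup>2 else 0)
    \<le> (\<Sum>t<T. if in_cell Nx a (xs (Suc t)) then (ys (Suc t) - f (xs (Suc t)))\<^sup>2 else 0)
      + 4 * B * (gam / 2 ^ M) * cell_count a
      + 180 * B * gam * M * S * sqrt (cell_count a) + 50 * B\<^sup>2 * L0" if a: "a \<in> {1..Nx}" for a
  proof -
    \<comment> \<open>Fixed for all subcells at once: the differences of level \<open>m\<close> must
      refer to the very approximant that the parent contributed at level \<open>m - 1\<close>,
      otherwise the sum would not telescope.\<close>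
    define Pf where "Pf m n = (SOME P. P \<in> Pmn B q Nx Ny a m n \<and>
      (\<forall>x\<in>{0..1}. in_sub Nx a m n x \<longrightarrow> \<bar>P x - f x\<bar> \<le> gam / 2 ^ m))" for m n
    have Pf: "Pf m n \<in> Pmn B q Nx Ny a m n \<and>
      (\<forall>x\<in>{0..1}. in_sub Nx a m n x \<longrightarrow> \<bar>Pf m n x - f x\<bar> \<le> gam / 2 ^ m)" if "n \<in> {1..4 ^ m}" for m n
      unfolding Pf_def
      by (rule someI_ex[OF holder_class_approx[OF f B Ny a that lam \<alpha> hx hy, unfolded Bex_def]])
    have "50 * B\<^sup>2 * ln (card (P0 B q Nx Ny a)) \<le> 50 * B\<^sup>2 * L0"
      by (intro mult_left_mono L0) simp
    moreover have "(\<Sum>t<T. if in_cell Nx a (xs (Suc t)) then (ys (Suc t) - nca_predict B q gam Nx Ny M xs ys (Suc t))\<^sup>2 else 0)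
      \<le> (\<Sum>t<T. if in_cell Nx a (xs (Suc t)) then (ys (Suc t) - f (xs (Suc t)))\<^sup>2 else 0)
        + 4 * B * (gam / 2 ^ M) * cell_count a
        + 180 * B * gam * M * S * sqrt (cell_count a) + 50 * B\<^sup>2 * ln (card (P0 B q Nx Ny a))"
    proof (rule cell_regret[OF a f_le, where Pf = Pf])
      show "Pf m n \<in> Pmn B q Nx Ny a m n" if "n \<in> {1..4 ^ m}" for m n
        using Pf[OF that] by (rule conjunct1)
      show "\<bar>Pf m n x - f x\<bar> \<le> gam / 2 ^ m" if "n \<in> {1..4 ^ m}" "x \<in> {0..1}" "in_sub Nx a m n x" for m n x
        using conjunct2[OF Pf[OF that(1)], rule_format, OF that(2,3)] .
    qed (use S[OF a] S0 in auto)
    ultimately show ?thesis by linarith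
  qed
  have counts: "(\<Sum>a=1..Nx. cell_count a) = T"
    unfolding cell_count_def sum_over_cells by simp
  have count0: "0 \<le> cell_count a" for a unfolding cell_count_def by (intro sum_nonneg) auto
  have "(\<Sum>a=1..Nx. sqrt (cell_count a))\<^sup>2 \<le> (\<Sum>a=1..Nx. (sqrt (cell_count a))\<^sup>2) * card {1..Nx}"
    by (rule sum_squared_le_sum_of_squares)
  also have "\<dots> = real Nx * T" using counts count0 by simp
  finally have sqrt_counts: "(\<Sum>a=1..Nx. sqrt (cell_count a)) \<le> sqrt (real Nx * T)"
    by (rule real_le_rsqrt)
  have "(\<Sum>t<T. (ys (Suc t) - nca_predict B q gam Nx Ny M xs ys (Suc t))\<^sup>2)
    \<le> (\<Sum>a=1..Nx. (\<Sum>t<T. if in_cell Nx a (xs (Suc t)) then (ys (Suc t) - f (xs (Suc t)))\<^sup>2 else 0)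
      + 4 * B * (gam / 2 ^ M) * cell_count a
      + 180 * B * gam * M * S * sqrt (cell_count a) + 50 * B\<^sup>2 * L0)"
    unfolding sum_over_cells[symmetric, of "\<lambda>t. (ys (Suc t) - nca_predict B q gam Nx Ny M xs ys (Suc t))\<^sup>2"]
    by (rule sum_mono[OF cell])
  also have "\<dots> = (\<Sum>t<T. (ys (Suc t) - f (xs (Suc t)))\<^sup>2) + 4 * B * (gam / 2 ^ M) * T
      + 180 * B * gam * M * S * (\<Sum>a=1..Nx. sqrt (cell_count a)) + Nx * (50 * B\<^sup>2 * L0)"
    unfolding sum.distrib sum_over_cells sum_distrib_left[symmetric] counts by simp
  also have "\<dots> \<le> (\<Sum>t<T. (ys (Suc t) - f (xs (Suc t)))\<^sup>2) + 4 * B * (gam / 2 ^ M) * T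
      + 180 * B * gam * M * S * sqrt (real Nx * T) + Nx * (50 * B\<^sup>2 * L0)"
    using B gam S0 by (intro add_mono order_refl mult_left_mono sqrt_counts) auto
  moreover have "(\<Sum>t=1..T. h t) = (\<Sum>t<T. h (Suc t))" for h :: "nat \<Rightarrow> real"
    by (simp add: sum.atLeast1_atMost_eq)
  ultimately show ?thesis unfolding S_def L0_def by simp
qed

end

section \<open>Tuning\<close>

lemma zero_in_holder_class:
  assumes "0 \<le> B" "0 \<le> lam"
  shows "(\<lambda>_. 0) \<in> holder_class q B lam \<alpha>"
  unfolding holder_class_def using assms by (auto intro!: exI[of _ "\<lambda>_ _. 0"])

lemma tuning_bounds:
  fixes B \<beta> lam gam dx K :: real and q T Nx Ny M :: nat
  assumes B: "0 < B" and \<beta>: "1/2 \<le> \<beta>" and lam: "0 < lam" and T: "2 \<le> T"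
    and gam_def: "gam = B * real T powr (- \<beta> / (2 * \<beta> + 1))"
    and dx_def: "dx = 2 * (fact q * gam / (2 * lam)) powr (1 / \<beta>)"
    and Nx_def: "Nx = nat \<lceil>1 / dx\<rceil>" and Ny_def: "Ny = nat \<lceil>2 * B / (gam / exp 1)\<rceil>"
    and M_def: "M = nat \<lceil>log 2 (gam * real T / B)\<rceil>"
    and K_def: "K = 1 + (max 1 (2 * lam / fact q))\<^sup>2"
  shows "0 < gam" "gam \<le> B" "0 < Nx" "0 < Ny"
    and "lam / fact q * (1 / (2 * real Nx)) powr \<beta> \<le> gam / 2"
    and "2 * B / real Ny \<le> gam / exp 1"
    and "gam / 2 ^ M * T \<le> B"
    and "real M \<le> 4 * ln T"
    and "ln (2 ^ M * real Ny + 1) \<le> 6 * ln T"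
    and "ln (real Ny + 1) \<le> 6 * ln T"
    and "real Nx \<le> K * max (B powr (- 1 / \<beta>)) 1 * real T powr (1 / (2 * \<beta> + 1))"
    and "gam * sqrt T * sqrt (real T powr (1 / (2 * \<beta> + 1))) = B * real T powr (1 / (2 * \<beta> + 1))"
proof -
  have T0: "0 < real T" "1 < real T" using T by auto
  have b: "0 < \<beta>" "0 < 2 * \<beta> + 1" using \<beta> by auto
  show gam: "0 < gam" using B T0 by (simp add: gam_def)
  have "real T powr (- \<beta> / (2 * \<beta> + 1)) \<le> real T powr 0"
    using T0 b by (intro powr_mono) (auto simp: divide_nonpos_pos)
  then have le1: "real T powr (- \<beta> / (2 * \<beta> + 1)) \<le> 1" using T0 by simp
  then have "B * real T powr (- \<beta> / (2 * \<beta> + 1)) \<le> B * 1" using B by (intro mult_left_mono) auto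
  then show "gam \<le> B" by (simp add: gam_def)
  have Tinv: "B / gam = real T powr (\<beta> / (2 * \<beta> + 1))"
    using B T0 by (simp add: gam_def powr_minus_divide)
  have X: "0 < fact q * gam / (2 * lam)" using gam lam by simp
  then have dx: "0 < dx" unfolding dx_def using gam lam by simp
  have Nx1: "1 / dx \<le> real Nx" unfolding Nx_def by linarith
  have Nx2: "real Nx \<le> 1 / dx + 1"
    unfolding Nx_def using dx by (simp add: ceiling_correct)
  show Nx: "0 < Nx" using Nx1 dx by (metis divide_pos_pos less_le_trans of_nat_0_less_iff zero_less_one)
  define z where "z = 2 * B / (gam / exp 1)"
  have z: "0 < z" using B gam by (simp add: z_def)
  have Ny1: "z \<le> real Ny" unfolding Ny_def z_def by linarith
  have Ny2: "real Ny \<le> z + 1" unfolding Ny_def z_def[symmetric] using z by linarith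
  show Ny: "0 < Ny" using Ny1 z by (metis less_le_trans of_nat_0_less_iff)
  show "2 * B / real Ny \<le> gam / exp 1"
    using Ny1 Ny gam B by (simp add: z_def field_simps)
  have "1 / (2 * real Nx) \<le> dx / 2" using Nx1 dx Nx by (simp add: field_simps)
  then have "(1 / (2 * real Nx)) powr \<beta> \<le> (dx / 2) powr \<beta>"
    using b by (intro powr_mono2) auto
  \<comment> \<open>\<open>dx\<close> solves
    \<open>lam / fact q * (dx / 2) powr \<beta> = gam / 2\<close>; rounding \<open>Nx\<close> up
    only shortens the cells.\<close>
  also have "\<dots> = fact q * gam / (2 * lam)" using gam lam b by (simp add: dx_def powr_powr)
  finally have "lam / fact q * (1 / (2 * real Nx)) powr \<beta> \<le> lam / fact q * (fact q * gam / (2 * lam))"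
    using lam by (intro mult_left_mono) auto
  then show "lam / fact q * (1 / (2 * real Nx)) powr \<beta> \<le> gam / 2" using lam by simp
  define R where "R = gam * real T / B"
  have R_eq: "R = real T powr (1 + - \<beta> / (2 * \<beta> + 1))"
    unfolding R_def gam_def powr_add using B T0 by simp
  have "0 \<le> 1 + - \<beta> / (2 * \<beta> + 1)" using b by (simp add: field_simps)
  then have R1: "1 \<le> R" unfolding R_eq using T0 by (intro ge_one_powr_ge_zero) auto
  have "R = real T * real T powr (- \<beta> / (2 * \<beta> + 1))" using B by (simp add: R_def gam_def)
  also have "\<dots> \<le> real T * 1" using T0 by (intro mult_left_mono le1) auto
  finally have RT: "R \<le> T" by simp
  have logR: "0 \<le> log 2 R" using R1 by simp
  have M1: "log 2 R \<le> real M" unfolding M_def R_def[symmetric] by linarith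
  have M2: "real M \<le> log 2 R + 1" unfolding M_def R_def[symmetric] using logR by linarith
  have "R = 2 powr (log 2 R)" using R1 by simp
  also have "\<dots> \<le> 2 powr (real M)" using M1 by (intro powr_mono) auto
  finally have RM: "R \<le> 2 ^ M" by (simp add: powr_realpow)
  have "(2::real) ^ M = 2 powr (real M)" by (simp add: powr_realpow)
  also have "\<dots> \<le> 2 powr (log 2 R + 1)" using M2 by (intro powr_mono) auto
  also have "\<dots> = 2 * R" using R1 by (simp add: powr_add)
  finally have M2T: "(2::real) ^ M \<le> 2 * T" using RT by linarith
  show "gam / 2 ^ M * T \<le> B" using RM B by (simp add: R_def field_simps)
  have lnT: "ln 2 \<le> ln (real T)" using T by simp
  have "log 2 R \<le> log 2 T" using R1 RT by (subst log_le_cancel_iff) auto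
  moreover have "1 \<le> log 2 T" using T0 T by (simp add: le_log_iff)
  ultimately have "real M \<le> 2 * log 2 T" using M2 by linarith
  also have "\<dots> = 2 / ln 2 * ln T" by (simp add: log_def)
  also have "\<dots> \<le> 4 * ln T"
    using T0 ln2_ge_two_thirds by (intro mult_right_mono) (auto simp: field_simps)
  finally show "real M \<le> 4 * ln T" .
  have "real T powr (\<beta> / (2 * \<beta> + 1)) \<le> real T powr 1"
    using T0 b by (intro powr_mono) (auto simp: field_simps)
  then have BT: "B / gam \<le> T" unfolding Tinv using T0 by simp
  have "z = 2 * exp 1 * (B / gam)" using gam by (simp add: z_def field_simps)
  also have "\<dots> \<le> 2 * 3 * real T" using BT B gam by (intro mult_mono exp_le) (auto simp: exp_le)
  finally have Ny7: "real Ny \<le> 7 * T" using Ny2 T0 by linarith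
  have ln6: "ln v \<le> 6 * ln T" if "0 < v" "v \<le> real T ^ 6" for v
  proof -
    have "ln v \<le> ln (real T ^ 6)" using that T0 by (subst ln_le_cancel_iff) auto
    then show ?thesis using T0 by (simp add: ln_realpow)
  qed
  have T2: "1 \<le> real T ^ 2" using T0 by simp
  \<comment> \<open>\<open>T \<ge> 2\<close> turns the factor 16 into \<open>T ^ 4\<close>, which is
    where the 6 in the logarithmic bounds comes from.\<close>
  have "(2::real) ^ 4 \<le> real T ^ 4" using T by (intro power_mono) auto
  then have "16 * real T ^ 2 \<le> real T ^ 4 * real T ^ 2" by (intro mult_right_mono) auto
  then have T6: "16 * real T ^ 2 \<le> real T ^ 6" by (simp add: power_add[symmetric])
  have "2 ^ M * real Ny \<le> real (2 * T) * real (7 * T)" using M2T Ny7 by (intro mult_mono) auto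
  then have "2 ^ M * real Ny + 1 \<le> 16 * real T ^ 2" using T2 by (simp add: power2_eq_square)
  then show 1: "ln (2 ^ M * real Ny + 1) \<le> 6 * ln T" using T6 by (intro ln6) (auto intro: add_nonneg_pos)
  have "1 * real Ny \<le> 2 ^ M * real Ny" by (intro mult_right_mono) auto
  then have "ln (real Ny + 1) \<le> ln (2 ^ M * real Ny + 1)" by (subst ln_le_cancel_iff) (auto simp: add_nonneg_pos)
  with 1 show "ln (real Ny + 1) \<le> 6 * ln T" by linarith
  define \<tau> where "\<tau> = real T powr (1 / (2 * \<beta> + 1))"
  define \<mu> where "\<mu> = max (B powr (- 1 / \<beta>)) 1"
  have \<tau>: "1 \<le> \<tau>" unfolding \<tau>_def using T0 b by (intro ge_one_powr_ge_zero) auto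
  have \<mu>: "1 \<le> \<mu>" by (simp add: \<mu>_def)
  define Y where "Y = (fact q * gam / (2 * lam)) powr (1 / \<beta>)"
  have "0 < Y" using dx by (simp add: dx_def Y_def)
  then have "1 / dx \<le> 1 / Y" unfolding dx_def Y_def[symmetric] by (simp add: field_simps)
  also have "1 / Y = (1 / (fact q * gam / (2 * lam))) powr (1 / \<beta>)"
    by (simp only: powr_divide powr_one_eq_one Y_def)
  also have "1 / (fact q * gam / (2 * lam)) = 2 * lam / fact q * ((1 / B) * (B / gam))"
    using B by simp
  also have "\<dots> powr (1 / \<beta>) = (2 * lam / fact q) powr (1 / \<beta>) * ((1 / B) powr (1 / \<beta>) * (B / gam) powr (1 / \<beta>))"
    by (simp only: powr_mult)
  also have "(B / gam) powr (1 / \<beta>) = \<tau>" unfolding Tinv \<tau>_def powr_powr using b by simp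
  also have "(1 / B) powr (1 / \<beta>) = B powr (- 1 / \<beta>)"
    using B by (simp add: powr_divide powr_minus_divide)
  \<comment> \<open>Raising the base to at least 1 permits replacing the exponent
    \<open>1 / \<beta> \<le> 2\<close> by 2; this makes \<open>K\<close> independent of
    \<open>\<alpha>\<close>.\<close>
  also have "(2 * lam / fact q) powr (1 / \<beta>) \<le> (max 1 (2 * lam / fact q)) powr (1 / \<beta>)"
    using lam b by (intro powr_mono2) auto
  also have "(max 1 (2 * lam / fact q)) powr (1 / \<beta>) \<le> (max 1 (2 * lam / fact q)) powr 2"
    using \<beta> b by (intro powr_mono) (auto simp: field_simps)
  also have "\<dots> = K - 1" by (simp add: K_def powr_realpow[of _ 2, simplified])
  finally have "1 / dx \<le> (K - 1) * (B powr (- 1 / \<beta>) * \<tau>)" using \<tau> by (simp add: mult_right_mono)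
  also have "\<dots> \<le> (K - 1) * (\<mu> * \<tau>)"
    using \<tau> by (intro mult_left_mono mult_right_mono) (auto simp: \<mu>_def K_def)
  finally have "real Nx \<le> (K - 1) * (\<mu> * \<tau>) + 1" using Nx2 by linarith
  \<comment> \<open>The cell gained by rounding \<open>Nx\<close> up is paid for by the summand 1 of
    \<open>K\<close>.\<close>
  moreover have "1 * 1 \<le> \<mu> * \<tau>" using \<mu> \<tau> by (intro mult_mono) auto
  ultimately show "real Nx \<le> K * \<mu> * \<tau>" by (simp add: algebra_simps)
  have "gam * sqrt T * sqrt \<tau> = B * (real T powr (- \<beta> / (2 * \<beta> + 1)) * real T powr (1 / 2)
      * real T powr (1 / (2 * \<beta> + 1) / 2))"
    using T0 by (simp add: gam_def \<tau>_def powr_half_sqrt[symmetric] powr_powr)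
  also have "\<dots> = B * real T powr (- \<beta> / (2 * \<beta> + 1) + 1 / 2 + 1 / (2 * \<beta> + 1) / 2)"
    by (simp only: powr_add)
  also have "- \<beta> / (2 * \<beta> + 1) + 1 / 2 + 1 / (2 * \<beta> + 1) / 2 = 1 / (2 * \<beta> + 1)"
    using b by (simp add: field_simps)
  finally show "gam * sqrt T * sqrt \<tau> = B * \<tau>" by (simp add: \<tau>_def)
qed

text \<open>The coefficients are \<open>4 * 8\<close>, \<open>180 * 4\<close> and
  \<open>50 * 12\<close>: the 8 and half of... the 12 lift lower powers of the logarithm to
  \<open>3/2\<close>, the 4 comes from the bound on \<open>M\<close>, and the 12 under the root is
  \<open>2 * 6\<close>.\<close>

lemma nca_tuned_regret:
  fixes B \<alpha> lam :: real and q T :: nat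
  assumes lam: "0 < lam" and B: "0 < B" and \<alpha>: "0 < \<alpha>" "1/2 \<le> real q + \<alpha>" and T: "2 \<le> T"
    and xs: "\<And>t. xs t \<in> {0..1}" and ys: "\<And>t. t \<in> {1..T} \<Longrightarrow> \<bar>ys t\<bar> \<le> B"
    and f: "f \<in> holder_class q B lam \<alpha>"
  defines "K \<equiv> 1 + (max 1 (2 * lam / fact q))\<^sup>2"
  shows "(\<Sum>t=1..T. (ys t - nca_tuned B q lam \<alpha> T xs ys t) ^ 2) - (\<Sum>t=1..T. (ys t - f (xs t)) ^ 2)
    \<le> (32 + 720 * sqrt (12 * (real q + 1)) * K + 600 * (real q + 1) * K)
      * max (B powr (2 - 1 / (real q + \<alpha>))) (B ^ 2)
      * real T powr (1 / (2 * (real q + \<alpha>) + 1)) * ln (real T) powr (3/2)"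
proof -
  define \<beta> where "\<beta> = real q + \<alpha>"
  define gam where "gam = B * real T powr (- \<beta> / (2 * \<beta> + 1))"
  define dx where "dx = 2 * (fact q * gam / (2 * lam)) powr (1 / \<beta>)"
  define Nx where "Nx = nat \<lceil>1 / dx\<rceil>"
  define Ny where "Ny = nat \<lceil>2 * B / (gam / exp 1)\<rceil>"
  define M where "M = nat \<lceil>log 2 (gam * real T / B)\<rceil>"
  define \<tau> where "\<tau> = real T powr (1 / (2 * \<beta> + 1))"
  define \<mu> where "\<mu> = max (B powr (- 1 / \<beta>)) 1"
  define l where "l = ln (real T)"
  have \<beta>: "1/2 \<le> \<beta>" using \<alpha> by (simp add: \<beta>_def)
  have "K = 1 + (max 1 (2 * lam / fact q))\<^sup>2" by (simp add: K_def)
  note tb = tuning_bounds[OF B \<beta> lam T gam_def dx_def Nx_def Ny_def M_def this, folded \<tau>_def \<mu>_def l_def]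
  interpret nested_chaining B gam q Nx Ny M T xs ys
    using B tb(1-4) xs ys by unfold_locales auto
  have tuned: "nca_tuned B q lam \<alpha> T xs ys t = nca_predict B q gam Nx Ny M xs ys t" for t
    unfolding nca_tuned_def Let_def \<beta>_def gam_def dx_def Nx_def Ny_def M_def ..
  have T0: "1 < real T" using T by simp
  \<comment> \<open>The logarithm is below 1 at \<open>T = 2\<close>, so lower powers of
    \<open>l\<close> are compared with \<open>l * sqrt l\<close> through this lower bound, at the
    price of factors 2 and 8.\<close>
  have l: "1/4 \<le> l" using ln2_ge_two_thirds T ln_le_cancel_iff[of 2 "real T"] unfolding l_def by linarith
  have l32: "l powr (3/2) = l * sqrt l"
  proof -
    have "l powr (3/2) = l powr (1 + 1/2)" by simp
    also have "\<dots> = l * sqrt l" using l by (simp only: powr_add powr_half_sqrt) simp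
    finally show ?thesis .
  qed
  have "sqrt (1/4) \<le> sqrt l" using l by (intro real_sqrt_le_mono)
  then have sl: "1/2 \<le> sqrt l" by (simp add: real_sqrt_divide)
  have "l * (1/2) \<le> l * sqrt l" using sl l by (intro mult_left_mono) auto
  then have l_le: "l \<le> 2 * (l * sqrt l)" by simp
  with l have one_le: "1 \<le> 8 * (l * sqrt l)" by linarith
  have \<tau>1: "1 \<le> \<tau>" unfolding \<tau>_def using T0 \<beta> by (intro ge_one_powr_ge_zero) auto
  have \<mu>1: "1 \<le> \<mu>" by (simp add: \<mu>_def)
  have K1: "1 \<le> K" by (simp add: K_def)
  have \<mu>\<tau>: "1 \<le> \<mu> * \<tau>" using mult_mono[OF \<mu>1 \<tau>1] \<mu>1 by simp
  have gs: "gam * sqrt (real Nx * T) \<le> B * K * \<mu> * \<tau>"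
  proof -
    have le_self: "sqrt v \<le> v" if "1 \<le> v" for v :: real
      using that mult_left_mono[OF that, of v] by (intro real_le_lsqrt) (auto simp: power2_eq_square)
    have "sqrt (real Nx) \<le> sqrt (K * \<mu> * \<tau>)" using tb(11) by (rule real_sqrt_le_mono)
    also have "\<dots> = sqrt K * sqrt \<mu> * sqrt \<tau>" by (simp add: real_sqrt_mult)
    \<comment> \<open>Only \<open>\<tau>\<close> must keep its root for the rate in
      \<open>T\<close>; \<open>K\<close> and \<open>\<mu>\<close> are at least 1, and the last term
      of the regret contains them in full anyway.\<close>
    also have "\<dots> \<le> K * \<mu> * sqrt \<tau>"
      using K1 \<mu>1 \<tau>1 by (intro mult_right_mono mult_mono le_self) auto
    finally have "gam * sqrt T * sqrt Nx \<le> gam * sqrt T * (K * \<mu> * sqrt \<tau>)"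
      using tb(1) by (intro mult_left_mono) auto
    also have "\<dots> = K * \<mu> * (gam * sqrt T * sqrt \<tau>)" by simp
    finally show ?thesis unfolding tb(12) by (simp add: real_sqrt_mult mult_ac)
  qed
  have "(\<Sum>t=1..T. (ys t - nca_tuned B q lam \<alpha> T xs ys t) ^ 2) - (\<Sum>t=1..T. (ys t - f (xs t)) ^ 2)
    \<le> 4 * B * (gam / 2 ^ M) * T
      + 180 * B * gam * M * sqrt (2 * (real q + 1) * ln (2 ^ M * real Ny + 1)) * sqrt (real Nx * T)
      + Nx * (50 * B\<^sup>2 * ((real q + 1) * ln (real Ny + 1)))"
    unfolding tuned using total_regret[OF f lam \<alpha>] tb(5,6) unfolding \<beta>_def by blast
  also have "4 * B * (gam / 2 ^ M) * T \<le> 32 * (B\<^sup>2 * \<mu> * \<tau> * (l * sqrt l))"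
  proof -
    have "4 * B * (gam / 2 ^ M * T) \<le> 4 * B * B" using tb(7) B by (intro mult_left_mono) auto
    also have "\<dots> = 4 * B\<^sup>2 * (1 * 1)" by (simp add: power2_eq_square)
    also have "\<dots> \<le> 4 * B\<^sup>2 * ((\<mu> * \<tau>) * (8 * (l * sqrt l)))"
      using one_le \<mu>\<tau> by (intro mult_left_mono mult_mono) auto
    finally show ?thesis by (simp add: mult_ac)
  qed
  also have "180 * B * gam * M * sqrt (2 * (real q + 1) * ln (2 ^ M * real Ny + 1)) * sqrt (real Nx * T)
      \<le> 720 * sqrt (12 * (real q + 1)) * K * (B\<^sup>2 * \<mu> * \<tau> * (l * sqrt l))"
  proof -
    have "sqrt (2 * (real q + 1) * ln (2 ^ M * real Ny + 1)) \<le> sqrt (2 * (real q + 1) * (6 * l))"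
      using tb(9) by (intro real_sqrt_le_mono mult_left_mono) auto
    also have "\<dots> = sqrt (12 * (real q + 1) * l)" by (simp add: algebra_simps)
    also have "\<dots> = sqrt (12 * (real q + 1)) * sqrt l" by (rule real_sqrt_mult)
    finally have "180 * B * (M * sqrt (2 * (real q + 1) * ln (2 ^ M * real Ny + 1)) * (gam * sqrt (real Nx * T)))
      \<le> 180 * B * ((4 * l) * (sqrt (12 * (real q + 1)) * sqrt l) * (B * K * \<mu> * \<tau>))"
      using tb(1,8) B l by (intro mult_left_mono mult_mono gs) auto
    then show ?thesis by (simp add: mult_ac power2_eq_square)
  qed
  also have "Nx * (50 * B\<^sup>2 * ((real q + 1) * ln (real Ny + 1)))
      \<le> 600 * (real q + 1) * K * (B\<^sup>2 * \<mu> * \<tau> * (l * sqrt l))"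
  proof -
    have "ln (real Ny + 1) \<le> 12 * (l * sqrt l)" using tb(10) l_le by linarith
    then have "Nx * (50 * B\<^sup>2 * ((real q + 1) * ln (real Ny + 1)))
      \<le> (K * \<mu> * \<tau>) * (50 * B\<^sup>2 * ((real q + 1) * (12 * (l * sqrt l))))"
      using tb(11) K1 \<mu>1 \<tau>1 by (intro mult_mono mult_left_mono) auto
    then show ?thesis by (simp add: mult_ac)
  qed
  finally have "(\<Sum>t=1..T. (ys t - nca_tuned B q lam \<alpha> T xs ys t) ^ 2) - (\<Sum>t=1..T. (ys t - f (xs t)) ^ 2)
    \<le> (32 + 720 * sqrt (12 * (real q + 1)) * K + 600 * (real q + 1) * K) * (B\<^sup>2 * \<mu>) * \<tau> * (l * sqrt l)"
    by (simp add: algebra_simps)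
  moreover have "B\<^sup>2 * \<mu> = max (B powr (2 - 1 / \<beta>)) (B ^ 2)"
  proof -
    have "B powr (2 - 1 / \<beta>) = B\<^sup>2 * B powr (- 1 / \<beta>)"
      using B by (simp add: powr_diff powr_minus_divide powr_realpow[of _ 2, simplified])
    then show ?thesis using B by (simp add: \<mu>_def max_mult_distrib_left)
  qed
  ultimately show ?thesis unfolding \<tau>_def \<beta>_def l_def[symmetric] l32 by simp
qed

theorem theorem11:
  fixes q :: nat and lam :: real
  assumes "lam > 0"
  shows "\<exists>c>0. \<forall>(B::real) (\<alpha>::real) (T::nat) (xs::nat \<Rightarrow> real) (ys::nat \<Rightarrow> real).
     B > 0 \<and> 0 < \<alpha> \<and> \<alpha> \<le> 1 \<and> real q + \<alpha> \<ge> 1/2 \<and> T \<ge> 2 \<and>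
     (\<forall>t. xs t \<in> {0..1}) \<and> (\<forall>t\<in>{1..T}. \<bar>ys t\<bar> \<le> B) \<longrightarrow>
       (\<Sum>t=1..T. (ys t - nca_tuned B q lam \<alpha> T xs ys t) ^ 2)
       - (INF f\<in>holder_class q B lam \<alpha>. \<Sum>t=1..T. (ys t - f (xs t)) ^ 2)
       \<le> c * max (B powr (2 - 1 / (real q + \<alpha>))) (B ^ 2)
            * real T powr (1 / (2 * (real q + \<alpha>) + 1)) * ln (real T) powr (3/2)"
proof -
  define K where "K = 1 + (max 1 (2 * lam / fact q))\<^sup>2"
  define c where "c = 32 + 720 * sqrt (12 * (real q + 1)) * K + 600 * (real q + 1) * K"
  have "0 < c" unfolding c_def K_def by (intro add_pos_nonneg mult_nonneg_nonneg) auto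
  moreover have "(\<Sum>t=1..T. (ys t - nca_tuned B q lam \<alpha> T xs ys t) ^ 2)
       - (INF f\<in>holder_class q B lam \<alpha>. \<Sum>t=1..T. (ys t - f (xs t)) ^ 2)
       \<le> c * max (B powr (2 - 1 / (real q + \<alpha>))) (B ^ 2)
            * real T powr (1 / (2 * (real q + \<alpha>) + 1)) * ln (real T) powr (3/2)" (is "?L - _ \<le> ?R")
    if h: "B > 0 \<and> 0 < \<alpha> \<and> \<alpha> \<le> 1 \<and> real q + \<alpha> \<ge> 1/2 \<and> T \<ge> 2 \<and>
     (\<forall>t. xs t \<in> {0..1}) \<and> (\<forall>t\<in>{1..T}. \<bar>ys t\<bar> \<le> B)" for B \<alpha> T xs ys
  proof -
    \<comment> \<open>The regret bound is uniform in \<open>f\<close>, so \<open>?L - ?R\<close> is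
      a lower bound of all comparator losses and no minimiser has to exist.\<close>
    have "?L - ?R \<le> (INF f\<in>holder_class q B lam \<alpha>. \<Sum>t=1..T. (ys t - f (xs t)) ^ 2)"
    proof (rule cINF_greatest)
      show "holder_class q B lam \<alpha> \<noteq> {}" using zero_in_holder_class[of B lam q \<alpha>] h assms by auto
      fix f assume "f \<in> holder_class q B lam \<alpha>"
      then show "?L - ?R \<le> (\<Sum>t=1..T. (ys t - f (xs t)) ^ 2)"
        using nca_tuned_regret[OF assms, of B \<alpha> q T xs ys f] h unfolding c_def K_def by simp
    qed
    then show ?thesis by simp
  qed
  ultimately show ?thesis by blast
qed

end
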